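(* Let $G$ be a finite group and let $p$ be a fixed prime divisor of $|G|$. Suppose that every maximal subgroup of $G$ is nilpotent, or normal in $G$, or has order not divisible by $p$. Then $G$ has a Sylow tower.
   Context: A finite group $G$ has a Sylow tower if, writing the distinct prime divisors of $|G|$ in a suitable order $p_1,\dots,p_s$ and taking $P_i\in\mathrm{Syl}_{p_i}(G)$, there is a chain of normal subgroups $P_1\trianglelefteq P_1P_2\trianglelefteq P_1P_2P_3\trianglelefteq\cdots\trianglelefteq P_1P_2\cdots P_s=G$, each term $P_1\cdots P_i$ being normal in $G$. *)

theory Defs
  imports "HOL-Algebra.Algebra" "HOL-Computational_Algebra.Primes"
begin

fun lower_central :: "('a, 'b) monoid_scheme \<Rightarrow> nat \<Rightarrow> 'a set" where
  "lower_central G 0 = carrier G"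
| "lower_central G (Suc n) =
     generate G {x \<otimes>\<^bsub>G\<^esub> y \<otimes>\<^bsub>G\<^esub> inv\<^bsub>G\<^esub> x \<otimes>\<^bsub>G\<^esub> inv\<^bsub>G\<^esub> y
                 | x y. x \<in> lower_central G n \<and> y \<in> carrier G}"

definition nilpotent_group :: "('a, 'b) monoid_scheme \<Rightarrow> bool" where
  "nilpotent_group G \<longleftrightarrow> group G \<and> (\<exists>n. lower_central G n = {\<one>\<^bsub>G\<^esub>})"

definition maximal_subgroup :: "'a set \<Rightarrow> ('a, 'b) monoid_scheme \<Rightarrow> bool" where
  "maximal_subgroup M G \<longleftrightarrow> subgroup M G \<and> M \<noteq> carrier G \<and>
     (\<forall>H. subgroup H G \<and> M \<subseteq> H \<longrightarrow> H = M \<or> H = carrier G)"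

definition sylow_subgroup :: "('a, 'b) monoid_scheme \<Rightarrow> nat \<Rightarrow> 'a set \<Rightarrow> bool" where
  "sylow_subgroup G p P \<longleftrightarrow> subgroup P G \<and> card P = p ^ multiplicity p (order G)"

fun set_prod_list :: "('a, 'b) monoid_scheme \<Rightarrow> 'a set list \<Rightarrow> 'a set" where
  "set_prod_list G [] = {\<one>\<^bsub>G\<^esub>}"
| "set_prod_list G (P # Ps) = P <#>\<^bsub>G\<^esub> set_prod_list G Ps"

definition has_sylow_tower :: "('a, 'b) monoid_scheme \<Rightarrow> bool" where
  "has_sylow_tower G \<longleftrightarrow>
     (\<exists>ps Ps. distinct ps \<and> set ps = prime_factors (order G) \<and> length Ps = length ps \<and>
        (\<forall>i < length ps. sylow_subgroup G (ps ! i) (Ps ! i)) \<and>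
        (\<forall>k \<in> {1..length ps}. set_prod_list G (take k Ps) \<lhd> G))"

end

theory Submission
  imports Defs
begin

text \<open>It suffices to find a nontrivial normal Sylow subgroup in every such \<open>G\<close>: the hypothesis passes to
quotients (if \<open>p\<close> divides the order of the kernel, it even passes in the form "every maximal subgroup
is nilpotent or normal"), so the tower can be built by repeatedly factoring out a normal Hall
subgroup.

If a Sylow \<open>p\<close>-subgroup \<open>P\<close> is not normal, the Frattini argument shows that its normalizer is a nilpotent
maximal subgroup. Let \<open>D\<close> be a largest intersection of two distinct Sylow \<open>p\<close>-subgroups. If \<open>D\<close> is
normal, all such intersections equal \<open>D\<close>, and the transfer into an abelian quotient of \<open>P\<close> killing \<open>D\<close>
is nontrivial; otherwise the normalizer of \<open>D\<close> lies in a maximal subgroup which cannot be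
nilpotent and is therefore normal, of \<open>p\<close>-power index. Either way \<open>G\<close> has a proper normal subgroup of
\<open>p\<close>-power index containing every normal \<open>p\<close>-subgroup. Consequently every maximal subgroup is nilpotent
or normal, and the same conclusion holds for every prime with a nonnormal Sylow subgroup.

Suppose that no nontrivial Sylow subgroup is normal. Choose a prime \<open>q\<close> for which the Sylow \<open>q\<close>-subgroup \<open>R\<close> of
\<open>M = N(P)\<close> is not Sylow in \<open>G\<close>. Then \<open>R\<close> is normal in \<open>G\<close>, so it lies in a proper normal subgroup \<open>K\<close> of
\<open>q\<close>-power index; comparing orders, \<open>M\<close> is contained in \<open>K\<close>, hence \<open>M = K\<close> is normal, a contradiction.\<close>

section \<open>Conjugation and normalizers\<close>

abbreviation (in group) conjugate :: "'a \<Rightarrow> 'a \<Rightarrow> 'a"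
  where "conjugate g x \<equiv> g \<otimes> x \<otimes> inv g"

lemma (in group) conjugate_mult:
  assumes "g \<in> carrier G" "x \<in> carrier G" "y \<in> carrier G"
  shows "conjugate g (x \<otimes> y) = conjugate g x \<otimes> conjugate g y"
  using assms by (simp add: m_assoc inv_solve_left)

lemma (in group) conjugate_conjugate:
  assumes "g \<in> carrier G" "h \<in> carrier G" "x \<in> carrier G"
  shows "conjugate g (conjugate h x) = conjugate (g \<otimes> h) x"
  using assms by (simp add: m_assoc inv_mult_group)

lemma (in group) conjugate_inv_cancel:
  assumes "g \<in> carrier G" "x \<in> carrier G"
  shows "conjugate (inv g) (conjugate g x) = x" "conjugate g (conjugate (inv g) x) = x"
proof -
  show "conjugate (inv g) (conjugate g x) = x"
    using conjugate_conjugate[of "inv g" g x] assms by simp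
  show "conjugate g (conjugate (inv g) x) = x"
    using conjugate_conjugate[of g "inv g" x] assms by simp
qed

lemma (in group) conjugate_inj_on:
  assumes "g \<in> carrier G" "A \<subseteq> carrier G"
  shows "inj_on (conjugate g) A"
  by (rule inj_on_inverseI[of _ "conjugate (inv g)"]) (use assms conjugate_inv_cancel in auto)

lemma (in group) conjugate_inv:
  assumes "g \<in> carrier G" "x \<in> carrier G"
  shows "conjugate g (inv x) = inv (conjugate g x)"
  using assms by (simp add: m_assoc inv_mult_group)

lemma (in group) subgroup_conjugate_image:
  assumes "g \<in> carrier G" "subgroup H G"
  shows "subgroup (conjugate g ` H) G"
proof (rule subgroupI)
  show "conjugate g ` H \<subseteq> carrier G"
    using assms subgroup.mem_carrier by fastforce
  show "conjugate g ` H \<noteq> {}"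
    using assms subgroup.one_closed by fastforce
next
  fix a assume "a \<in> conjugate g ` H"
  then obtain h where "h \<in> H" "a = conjugate g h" by blast
  then show "inv a \<in> conjugate g ` H"
    using assms conjugate_inv[of g h] subgroup.mem_carrier[of H G h]
    by (auto intro!: image_eqI[of _ _ "inv h"] simp: subgroup.m_inv_closed)
next
  fix a b assume "a \<in> conjugate g ` H" "b \<in> conjugate g ` H"
  then obtain h k where "h \<in> H" "a = conjugate g h" "k \<in> H" "b = conjugate g k" by blast
  then show "a \<otimes> b \<in> conjugate g ` H"
    using assms conjugate_mult[of g h k] subgroup.mem_carrier[of H G]
    by (auto intro!: image_eqI[of _ _ "h \<otimes> k"] simp: subgroup.m_closed)
qed

lemma (in group) card_conjugate_image:
  assumes "g \<in> carrier G" "H \<subseteq> carrier G"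
  shows "card (conjugate g ` H) = card H"
  using conjugate_inj_on[OF assms] by (rule card_image)

text \<open>Conjugation is injective, so for a finite \<open>P\<close> an inclusion between
  \<open>P\<close> and its conjugate is an equality. Membership in a normalizer can therefore be
  checked by an inclusion alone.\<close>

lemma (in group) mem_normalizer_iff:
  assumes "finite P" "subgroup P G"
  shows "g \<in> normalizer G P \<longleftrightarrow> g \<in> carrier G \<and> conjugate g ` P \<subseteq> P"
proof -
  have PG: "P \<subseteq> carrier G" using assms(2) by (rule subgroup.subset)
  have im: "g <# P #> inv g = conjugate g ` P"
    by (auto simp: l_coset_def r_coset_def)
  have "g <# P #> inv g = P \<longleftrightarrow> conjugate g ` P \<subseteq> P" if "g \<in> carrier G"
    unfolding im using card_conjugate_image[OF that PG] assms(1)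
    by (metis card_subset_eq order_refl)
  then show ?thesis
    using PG by (auto simp: normalizer_def stabilizer_def)
qed

lemma (in group) subgroup_normalizer: "subgroup P G \<Longrightarrow> subgroup (normalizer G P) G"
  using normalizer_imp_subgroup subgroup.subset by blast

lemma (in group) subset_normalizer:
  assumes "finite P" "subgroup P G"
  shows "P \<subseteq> normalizer G P"
  using assms by (auto simp: mem_normalizer_iff subgroup.mem_carrier subgroup.m_closed subgroup.m_inv_closed)

lemma (in group) normal_iff_conjugate:
  "N \<lhd> G \<longleftrightarrow> subgroup N G \<and> (\<forall>g\<in>carrier G. conjugate g ` N \<subseteq> N)"
  unfolding normal_inv_iff by blast

lemma (in group) normal_iff_normalizer:
  assumes "finite P" "subgroup P G"
  shows "P \<lhd> G \<longleftrightarrow> normalizer G P = carrier G"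
proof -
  have "normalizer G P \<subseteq> carrier G"
    using assms subgroup_normalizer subgroup.subset by blast
  then show ?thesis
    using assms mem_normalizer_iff[OF assms] unfolding normal_iff_conjugate by blast
qed

lemma (in group) subgroup_restrict_iff:
  assumes "subgroup M G"
  shows "subgroup N (G\<lparr>carrier := M\<rparr>) \<longleftrightarrow> subgroup N G \<and> N \<subseteq> M"
  using assms incl_subgroup[of M N] subgroup_incl[of N M]
    subgroup.subset[of N "G\<lparr>carrier := M\<rparr>"] by auto

lemma (in group) normal_restrict_iff:
  assumes "subgroup M G"
  shows "N \<lhd> G\<lparr>carrier := M\<rparr> \<longleftrightarrow> subgroup N G \<and> N \<subseteq> M \<and> (\<forall>g\<in>M. conjugate g ` N \<subseteq> N)"
proof -
  have "conjugate g ` N \<subseteq> N \<longleftrightarrow> (\<forall>h\<in>N. g \<otimes> h \<otimes> inv\<^bsub>G\<lparr>carrier := M\<rparr>\<^esub> g \<in> N)" if "g \<in> M" for g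
    using m_inv_consistent[OF assms that] by auto
  then show ?thesis
    unfolding group.normal_inv_iff[OF subgroup_imp_group[OF assms]] subgroup_restrict_iff[OF assms]
    by auto
qed

lemma (in group) normal_in_normalizer:
  assumes "finite P" "subgroup P G" "subgroup M G" "P \<subseteq> M"
  shows "P \<lhd> G\<lparr>carrier := M\<rparr> \<longleftrightarrow> M \<subseteq> normalizer G P"
  using assms mem_normalizer_iff[OF assms(1,2)] subgroup.mem_carrier[OF assms(3)]
  unfolding normal_restrict_iff[OF assms(3)] by auto

section \<open>Orders of subgroups and of products with a normal subgroup\<close>

lemma (in group) card_subgroup_dvd:
  assumes "subgroup H G" "subgroup K G" "H \<subseteq> K"
  shows "card H dvd card K"
proof -
  have "card (rcosets\<^bsub>G\<lparr>carrier := K\<rparr>\<^esub> H) * card H = card K"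
    using group.lagrange[OF subgroup_imp_group[OF assms(2)]] subgroup_incl[OF assms]
    by (simp add: order_def)
  then show ?thesis by (metis dvd_triv_right)
qed

lemma (in group) card_subgroup_dvd_order: "subgroup H G \<Longrightarrow> card H dvd order G"
  using lagrange by (metis dvd_triv_right)

text \<open>By the second isomorphism theorem \<open>N\<close> has as many cosets in
  \<open>N <#> H\<close> as \<open>N \<inter> H\<close> has in \<open>H\<close>; Lagrange turns this
  into the product formula.\<close>

lemma (in group) card_normal_mult_subgroup:
  assumes "N \<lhd> G" "subgroup H G" "finite (carrier G)"
  shows "card (N <#> H) * card (N \<inter> H) = card N * card H"
proof -
  interpret second_isomorphism_grp N G H
    using assms by (simp add: second_isomorphism_grp_def second_isomorphism_grp_axioms_def)
  let ?NH = "G\<lparr>carrier := N <#> H\<rparr>"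
  have iso: "(G\<lparr>carrier := H\<rparr> Mod (N \<inter> H)) \<cong> (?NH Mod N)"
    using normal_intersection_quotient_isom is_isoI by blast
  have "card (rcosets\<^bsub>?NH\<^esub> N) * card N = card (N <#> H)"
    using group.lagrange[OF subgroup_imp_group[OF normal_set_mult_subgroup], of N]
      subgroup_incl[OF subgroup_axioms normal_set_mult_subgroup H_contained_in_set_mult]
    by (simp add: order_def)
  moreover have "card (rcosets\<^bsub>G\<lparr>carrier := H\<rparr>\<^esub> (N \<inter> H)) * card (N \<inter> H) = card H"
    using group.lagrange[OF subgroup_imp_group[OF assms(2)], of "N \<inter> H"]
      subgroup_incl[OF subgroups_Inter_pair[OF subgroup_axioms assms(2)] assms(2)]
    by (simp add: order_def)
  moreover have "card (rcosets\<^bsub>G\<lparr>carrier := H\<rparr>\<^esub> (N \<inter> H)) = card (rcosets\<^bsub>?NH\<^esub> N)"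
    using iso_same_card[OF iso] by (simp add: FactGroup_def)
  ultimately show ?thesis by (metis mult.assoc mult.commute)
qed

lemma (in group) subgroup_normal_mult:
  assumes "N \<lhd> G" "subgroup H G"
  shows "subgroup (N <#> H) G" "N \<subseteq> N <#> H" "H \<subseteq> N <#> H"
proof -
  interpret second_isomorphism_grp N G H
    using assms by (simp add: second_isomorphism_grp_def second_isomorphism_grp_axioms_def)
  show "subgroup (N <#> H) G" by (rule normal_set_mult_subgroup)
  show "N \<subseteq> N <#> H" using H_contained_in_set_mult by (auto dest: subgroup.subset)
  show "H \<subseteq> N <#> H" by (rule S_contained_in_set_mult)
qed

section \<open>Sylow subgroups\<close>

text \<open>The orbit of a point that is not fixed has more than one element and its length divides
  \<open>p ^ k\<close>, so \<open>p\<close> divides it. These orbits partition the complement of the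
  fixed points.\<close>

lemma (in group_action) card_fixed_points_mod:
  assumes "finite E" "Factorial_Ring.prime p" "order G = p ^ k"
  shows "card {x\<in>E. \<forall>g\<in>carrier G. \<phi> g x = x} mod p = card E mod p"
proof -
  define F where "F = {x\<in>E. \<forall>g\<in>carrier G. \<phi> g x = x}"
  define C where "C = orbit G \<phi> ` (E - F)"
  interpret G: group G using group_hom group_hom.axioms(1) by auto
  have sub: "orbit G \<phi> x \<subseteq> E" if "x \<in> E" for x
    using that element_image by (auto simp: orbit_def)
  have orb: "orbit G \<phi> x \<subseteq> E - F" if "x \<in> E - F" for x
  proof
    fix y assume y: "y \<in> orbit G \<phi> x"
    then have "y \<in> E" using that sub by blast
    moreover have "y \<notin> F"
    proof
      assume "y \<in> F"
      then have "orbit G \<phi> y = {y}" using G.one_closed by (force simp: F_def orbit_def)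
      moreover have "x \<in> orbit G \<phi> y" using orbit_sym[of x y] y that \<open>y \<in> E\<close> by blast
      ultimately show False using \<open>y \<in> F\<close> that by auto
    qed
    ultimately show "y \<in> E - F" by blast
  qed
  have U: "\<Union>C = E - F"
    using orb orbit_refl by (auto simp: C_def)
  have "p dvd card c" if c: "c \<in> C" for c
  proof -
    obtain x where x: "x \<in> E" "x \<notin> F" and cx: "c = orbit G \<phi> x" using c by (auto simp: C_def)
    have "card c dvd p ^ k"
      unfolding cx using orbit_stabilizer_theorem[OF x(1)] assms(3) by (metis dvd_triv_left)
    then obtain i where i: "card c = p ^ i" using assms(2) divides_primepow_nat by blast
    obtain g where g: "g \<in> carrier G" "\<phi> g x \<noteq> x" using x by (auto simp: F_def)
    have "finite c" unfolding cx using sub[OF x(1)] assms(1) finite_subset by blast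
    moreover have "{x, \<phi> g x} \<subseteq> c" unfolding cx using g orbit_refl[OF x(1)] by (auto simp: orbit_def)
    ultimately have "2 \<le> card c" using g by (metis card_2_iff card_mono)
    then have "i \<noteq> 0" using i by (cases i) auto
    then show ?thesis using i by (simp add: dvd_power)
  qed
  moreover have "pairwise disjnt C"
    using disjoint_union by (fastforce simp: pairwise_def disjnt_def C_def orbits_def)
  ultimately have "p dvd card (E - F)"
    using dvd_partition[of C p] assms(1) U by (fastforce simp: pairwise_def disjnt_def)
  moreover have "card E = card F + card (E - F)"
    using assms(1) by (metis (no_types, lifting) F_def card_mono card_Diff_subset finite_subset
        le_add_diff_inverse mem_Collect_eq subsetI)
  ultimately show ?thesis unfolding F_def[symmetric]
    by (metis add.right_neutral mod_add_right_eq mod_0_imp_dvd dvd_imp_mod_0)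
qed

lemma (in group) rcos_mult_closed:
  assumes "subgroup H G" "C \<in> rcosets H" "x \<in> carrier G"
  shows "C #> x \<in> rcosets H"
  using assms coset_mult_assoc[OF subgroup.subset] by (force simp: RCOSETS_def)

lemma (in group) rcos_mult_mult:
  assumes "subgroup H G" "C \<in> rcosets H" "x \<in> carrier G" "y \<in> carrier G"
  shows "C #> x #> y = C #> (x \<otimes> y)"
  using coset_mult_assoc[OF subgroup.rcosets_carrier[OF assms(1) is_group assms(2)] assms(3,4)] .

lemma (in group) bij_betw_rcos_mult:
  assumes "subgroup H G" "x \<in> carrier G"
  shows "bij_betw (\<lambda>C. C #> x) (rcosets H) (rcosets H)"
proof (rule bij_betw_byWitness[of _ "\<lambda>C. C #> inv x"])
  show "\<forall>C\<in>rcosets H. C #> x #> inv x = C" "\<forall>C\<in>rcosets H. C #> inv x #> x = C"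
    using assms rcos_mult_mult coset_mult_one subgroup.rcosets_carrier is_group by force+
qed (use assms rcos_mult_closed in auto)

text \<open>Right multiplication acts on right cosets from the wrong side; the inverse makes it a
  left action, and restricting each map to \<open>rcosets H\<close> puts it into
  \<open>Bij\<close>.\<close>

lemma (in group) rcosets_action:
  assumes H: "subgroup H G" and Q: "subgroup Q G"
  shows "group_action (G\<lparr>carrier := Q\<rparr>) (rcosets H) (\<lambda>x. \<lambda>C\<in>rcosets H. C #> inv x)"
proof -
  let ?\<phi> = "\<lambda>x. \<lambda>C\<in>rcosets H. C #> inv x"
  have bij: "?\<phi> x \<in> Bij (rcosets H)" if "x \<in> Q" for x
    using bij_betw_rcos_mult[OF H, of "inv x"] subgroup.mem_carrier[OF Q that]
      bij_betw_cong[of "rcosets H" "?\<phi> x" "\<lambda>C. C #> inv x"]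
    by (auto simp: Bij_def)
  have "?\<phi> (x \<otimes> y) = compose (rcosets H) (?\<phi> x) (?\<phi> y)" if "x \<in> Q" "y \<in> Q" for x y
  proof
    fix C
    show "?\<phi> (x \<otimes> y) C = compose (rcosets H) (?\<phi> x) (?\<phi> y) C"
      using that subgroup.mem_carrier[OF Q] rcos_mult_closed[OF H] rcos_mult_mult[OF H]
      by (auto simp: compose_def inv_mult_group)
  qed
  then have "?\<phi> \<in> hom (G\<lparr>carrier := Q\<rparr>) (BijGroup (rcosets H))"
    using bij by (auto simp: hom_def BijGroup_def)
  then show ?thesis
    using subgroup_imp_group[OF Q] group_BijGroup
    by (simp add: group_action_def group_hom_def group_hom_axioms_def)
qed

lemma (in group) card_fixed_rcosets_mod:
  assumes fin: "finite (carrier G)" and p: "Factorial_Ring.prime p" and H: "subgroup H G"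
    and Q: "subgroup Q G" "card Q = p ^ k"
  shows "card {C\<in>rcosets H. \<forall>x\<in>Q. C #> x = C} mod p = card (rcosets H) mod p"
proof -
  interpret act: group_action "G\<lparr>carrier := Q\<rparr>" "rcosets H" "\<lambda>x. \<lambda>C\<in>rcosets H. C #> inv x"
    using H Q(1) by (rule rcosets_action)
  have "finite (rcosets H)" using fin H by (meson finite_Pow_iff finite_subset rcosets_subset_PowG)
  then have "card {C\<in>rcosets H. \<forall>x\<in>Q. C #> inv x = C} mod p = card (rcosets H) mod p"
    using act.card_fixed_points_mod[OF _ p, of k] Q(2)
    by (simp add: order_def restrict_apply' cong: conj_cong)
  \<comment> \<open>As \<open>x\<close> runs through the subgroup \<open>Q\<close>, so does its
    inverse, which removes the inverse that the left action introduced.\<close>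
  moreover have "(\<forall>x\<in>Q. C #> inv x = C) \<longleftrightarrow> (\<forall>x\<in>Q. C #> x = C)" for C
    using subgroup.m_inv_closed[OF Q(1)] subgroup.mem_carrier[OF Q(1)] by (metis inv_inv)
  ultimately show ?thesis by simp
qed

text \<open>This translates the counting of fixed cosets into statements about conjugates lying in
  \<open>H\<close>, and for \<open>H\<close> itself into membership in its normalizer.\<close>

lemma (in group) rcos_fixed_iff:
  assumes "subgroup H G" "g \<in> carrier G" "x \<in> carrier G"
  shows "(H #> g) #> x = H #> g \<longleftrightarrow> conjugate g x \<in> H"
proof -
  have HG: "H \<subseteq> carrier G" using assms(1) by (rule subgroup.subset)
  have "(H #> g) #> x = H #> g \<longleftrightarrow> g \<otimes> x \<in> H #> g"
    using assms HG coset_mult_assoc repr_independence rcos_self m_closed by metis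
  also have "\<dots> \<longleftrightarrow> conjugate g x \<in> H"
    using subgroup.rcos_module[OF assms(1) is_group assms(2), of "g \<otimes> x"] assms by simp
  finally show ?thesis .
qed

section \<open>Existence, conjugacy and the Frattini argument\<close>

lemma (in group) sylow_subgroup_exists:
  assumes "finite (carrier G)" "Factorial_Ring.prime p"
  obtains P where "sylow_subgroup G p P"
proof -
  obtain m where "order G = p ^ multiplicity p (order G) * m"
    using multiplicity_dvd by blast
  then show ?thesis
    using sylow_thm[OF assms(2) is_group _ assms(1)] that unfolding sylow_subgroup_def by blast
qed

lemma (in group) sylow_index_not_dvd:
  assumes "finite (carrier G)" "Factorial_Ring.prime p" "sylow_subgroup G p P"
  shows "\<not> p dvd card (rcosets P)"
proof
  assume "p dvd card (rcosets P)"
  then have "p ^ Suc (multiplicity p (order G)) dvd order G"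
    using assms(3) lagrange[of P] unfolding sylow_subgroup_def by (metis mult_dvd_mono dvd_refl power_Suc)
  moreover have "order G \<noteq> 0" using assms(1) order_gt_0_iff_finite by simp
  moreover have "\<not> is_unit p" using assms(2) by (simp add: prime_nat_iff)
  ultimately show False using multiplicity_geI Suc_n_not_le_n by blast
qed

text \<open>The \<open>p\<close>-group \<open>Q\<close> acts on the cosets of \<open>P\<close>,
  whose number is prime to \<open>p\<close>. Hence some coset \<open>P #> g\<close> is fixed, and
  fixing it means that \<open>g\<close> conjugates \<open>Q\<close> into \<open>P\<close>.\<close>

lemma (in group) sylow_contains_conjugate:
  assumes fin: "finite (carrier G)" and p: "Factorial_Ring.prime p" and P: "sylow_subgroup G p P"
    and Q: "subgroup Q G" "card Q = p ^ k"
  obtains g where "g \<in> carrier G" "conjugate g ` Q \<subseteq> P"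
proof -
  have PG: "subgroup P G" using P by (simp add: sylow_subgroup_def)
  let ?F = "{C\<in>rcosets P. \<forall>x\<in>Q. C #> x = C}"
  have "card ?F mod p \<noteq> 0"
    using card_fixed_rcosets_mod[OF fin p PG Q] sylow_index_not_dvd[OF fin p P] by (simp add: mod_eq_0_iff_dvd)
  then have "?F \<noteq> {}" by force
  then obtain g where "g \<in> carrier G" "\<forall>x\<in>Q. P #> g #> x = P #> g" by (auto simp: RCOSETS_def)
  then show ?thesis
    using that rcos_fixed_iff[OF PG] subgroup.mem_carrier[OF Q(1)] by blast
qed

lemma (in group) card_sylow: "sylow_subgroup G p P \<Longrightarrow> card P = p ^ multiplicity p (order G)"
  by (simp add: sylow_subgroup_def)

lemma (in group) sylow_conjugate_image:
  assumes "sylow_subgroup G p P" "g \<in> carrier G"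
  shows "sylow_subgroup G p (conjugate g ` P)"
  using assms subgroup_conjugate_image[of g P] card_conjugate_image[of g P] subgroup.subset[of P G]
  by (simp add: sylow_subgroup_def)

lemma (in group) sylow_conjugate:
  assumes fin: "finite (carrier G)" and p: "Factorial_Ring.prime p" and P: "sylow_subgroup G p P"
    and Q: "sylow_subgroup G p Q"
  obtains g where "g \<in> carrier G" "conjugate g ` Q = P"
proof -
  obtain g where g: "g \<in> carrier G" "conjugate g ` Q \<subseteq> P"
    using sylow_contains_conjugate[OF fin p P] Q unfolding sylow_subgroup_def by blast
  have "finite P" using P fin finite_subset subgroup.subset by (auto simp: sylow_subgroup_def)
  then have "conjugate g ` Q = P"
    using g card_sylow[OF P] card_sylow[OF sylow_conjugate_image[OF Q g(1)]] by (metis card_subset_eq)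
  then show ?thesis using that g by blast
qed

lemma (in group) p_subgroup_in_sylow:
  assumes fin: "finite (carrier G)" and p: "Factorial_Ring.prime p"
    and Q: "subgroup Q G" "card Q = p ^ k"
  obtains P where "sylow_subgroup G p P" "Q \<subseteq> P"
proof -
  obtain P where P: "sylow_subgroup G p P" using sylow_subgroup_exists[OF fin p] .
  then obtain g where g: "g \<in> carrier G" "conjugate g ` Q \<subseteq> P"
    using sylow_contains_conjugate[OF fin p P Q] by blast
  have "Q \<subseteq> conjugate (inv g) ` P"
  proof
    fix x assume x: "x \<in> Q"
    then have "x = conjugate (inv g) (conjugate g x)"
      using conjugate_inv_cancel(1) g(1) subgroup.mem_carrier[OF Q(1)] by metis
    then show "x \<in> conjugate (inv g) ` P" using g(2) x by blast
  qed
  then show ?thesis using that sylow_conjugate_image[OF P, of "inv g"] g(1) by blast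
qed

lemma (in group) normal_p_subgroup_in_sylow:
  assumes fin: "finite (carrier G)" and p: "Factorial_Ring.prime p" and P: "sylow_subgroup G p P"
    and Q: "Q \<lhd> G" "card Q = p ^ k"
  shows "Q \<subseteq> P"
proof -
  have QG: "subgroup Q G" and c: "\<forall>g\<in>carrier G. conjugate g ` Q \<subseteq> Q"
    using Q(1) normal_iff_conjugate by blast+
  obtain g where g: "g \<in> carrier G" "conjugate g ` Q \<subseteq> P"
    using sylow_contains_conjugate[OF fin p P QG Q(2)] .
  have fQ: "finite Q" using fin QG finite_subset subgroup.subset by auto
  have "conjugate g ` Q = Q"
    using c g(1) fQ card_conjugate_image[OF g(1) subgroup.subset[OF QG]] by (metis card_subset_eq)
  then show ?thesis using g(2) by simp
qed

text \<open>Let \<open>D\<close> act on its own cosets in \<open>P\<close>. Their number is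
  divisible by \<open>p\<close>, hence so is the number of fixed ones. The coset \<open>D\<close> is
  fixed, so there is another fixed coset \<open>D #> x\<close>, and then \<open>x\<close> normalizes
  \<open>D\<close>.\<close>

lemma (in group) p_group_normalizer_grows:
  assumes fin: "finite (carrier G)" and p: "Factorial_Ring.prime p" and P: "subgroup P G" "card P = p ^ k"
    and D: "subgroup D G" "D \<subset> P"
  obtains x where "x \<in> P" "x \<notin> D" "x \<in> normalizer G D"
proof -
  interpret P: group "G\<lparr>carrier := P\<rparr>" using P(1) by (rule subgroup_imp_group)
  have finP: "finite P" using fin P(1) finite_subset subgroup.subset by auto
  then have finD: "finite D" using D finite_subset by auto
  have DP: "subgroup D (G\<lparr>carrier := P\<rparr>)" using subgroup_incl[OF D(1) P(1)] D(2) by auto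
  have "card D dvd p ^ k" using card_subgroup_dvd[OF D(1) P(1)] D(2) P(2) by auto
  then obtain i where i: "i \<le> k" "card D = p ^ i" using p divides_primepow_nat by blast
  have "card D < card P" using D(2) finP psubset_card_mono by blast
  then have "i < k" using i P(2) by (cases "i = k") auto
  let ?R = "rcosets\<^bsub>G\<lparr>carrier := P\<rparr>\<^esub> D"
  let ?F = "{C\<in>?R. \<forall>x\<in>D. C #> x = C}"
  have "card ?R * p ^ i = p ^ (k - i) * p ^ i"
    using P.lagrange[OF DP] P(2) i \<open>i < k\<close> by (simp add: order_def flip: power_add)
  moreover have "p > 0" using p by (simp add: prime_gt_0_nat)
  ultimately have "card ?R = p ^ (k - i)" by simp
  then have "p dvd card ?R" using \<open>i < k\<close> by (simp add: dvd_power)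
  then have pF: "p dvd card ?F"
    using P.card_fixed_rcosets_mod[OF _ p DP DP i(2)] finP
    by (simp add: mod_eq_0_iff_dvd[symmetric])
  have "D #> \<one> \<in> ?F"
    using P.rcosetsI[of D \<one>] P.one_closed D subgroup.subset[OF D(1)] coset_join2[OF _ D(1)]
    by (auto simp: coset_mult_one subgroup.mem_carrier[OF D(1)])
  then have DF: "D \<in> ?F" using subgroup.subset[OF D(1)] by (simp add: coset_mult_one)
  have "?F \<noteq> {D}" using pF p by (auto simp: prime_nat_iff)
  then obtain C where C: "C \<in> ?F" "C \<noteq> D" using DF by blast
  from C(1) have "C \<in> ?R" by blast
  then obtain x where x: "x \<in> P" "C = D #> x" unfolding RCOSETS_def by auto
  have xG: "x \<in> carrier G" using x(1) subgroup.mem_carrier[OF P(1)] by blast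
  have "x \<notin> D" using C(2) x(2) coset_join2[OF xG D(1)] by blast
  moreover have "conjugate x ` D \<subseteq> D"
    using C(1) x(2) rcos_fixed_iff[OF D(1) xG] subgroup.mem_carrier[OF D(1)] by auto
  then have "x \<in> normalizer G D" using xG mem_normalizer_iff[OF finD D(1)] by blast
  ultimately show ?thesis using that x(1) by blast
qed

lemma (in group) sylow_restrict:
  assumes fin: "finite (carrier G)" and p: "Factorial_Ring.prime p" and P: "sylow_subgroup G p P"
    and M: "subgroup M G" "P \<subseteq> M"
  shows "sylow_subgroup (G\<lparr>carrier := M\<rparr>) p P"
proof -
  have PG: "subgroup P G" and cP: "card P = p ^ multiplicity p (order G)"
    using P by (simp_all add: sylow_subgroup_def)
  have o: "order G \<noteq> 0" using fin order_gt_0_iff_finite by simp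
  have M0: "card M \<noteq> 0" using fin M(1) subgroup.finite_imp_card_positive by force
  have "\<not> is_unit p" using p by (simp add: prime_nat_iff)
  moreover have "p ^ multiplicity p (order G) dvd card M"
    using card_subgroup_dvd[OF PG M] cP by simp
  ultimately have "multiplicity p (order G) \<le> multiplicity p (card M)"
    using M0 multiplicity_geI by blast
  moreover have "multiplicity p (card M) \<le> multiplicity p (order G)"
    using o card_subgroup_dvd_order[OF M(1)] by (rule dvd_imp_multiplicity_le[rotated])
  ultimately show ?thesis
    using subgroup_incl[OF PG M] cP by (simp add: sylow_subgroup_def order_def)
qed

lemma (in group) sylow_conjugate_in_subgroup:
  assumes fin: "finite (carrier G)" and p: "Factorial_Ring.prime p" and M: "subgroup M G"
    and P: "sylow_subgroup (G\<lparr>carrier := M\<rparr>) p P" and Q: "sylow_subgroup (G\<lparr>carrier := M\<rparr>) p Q"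
  obtains n where "n \<in> M" "conjugate n ` Q = P"
proof -
  interpret M: group "G\<lparr>carrier := M\<rparr>" using M by (rule subgroup_imp_group)
  have "finite (carrier (G\<lparr>carrier := M\<rparr>))"
    using fin finite_subset subgroup.subset[OF M] by simp
  then obtain n where n: "n \<in> carrier (G\<lparr>carrier := M\<rparr>)" "M.conjugate n ` Q = P"
    using M.sylow_conjugate[OF _ p P Q] by blast
  have nM: "n \<in> M" using n(1) by simp
  show ?thesis
    by (rule that[OF nM]) (use n(2) m_inv_consistent[OF M nM] in simp)
qed

text \<open>Both \<open>P\<close> and its conjugate by \<open>g\<close> are Sylow subgroups of
  \<open>N\<close>, so some \<open>n\<close> in \<open>N\<close> moves the conjugate back to
  \<open>P\<close>. This is the common core of the Frattini argument and of the fact that Sylow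
  normalizers are self-normalizing.\<close>

lemma (in group) sylow_conjugator_mod_normalizer:
  assumes fin: "finite (carrier G)" and p: "Factorial_Ring.prime p" and P: "sylow_subgroup G p P"
    and N: "subgroup N G" "P \<subseteq> N" and g: "g \<in> carrier G" "conjugate g ` P \<subseteq> N"
  obtains n where "n \<in> N" "n \<otimes> g \<in> normalizer G P"
proof -
  have PG: "subgroup P G" using P by (simp add: sylow_subgroup_def)
  have finP: "finite P" using fin PG finite_subset subgroup.subset by auto
  have "sylow_subgroup (G\<lparr>carrier := N\<rparr>) p (conjugate g ` P)"
    using sylow_restrict[OF fin p sylow_conjugate_image[OF P g(1)] N(1) g(2)] .
  moreover have "sylow_subgroup (G\<lparr>carrier := N\<rparr>) p P"
    using sylow_restrict[OF fin p P N] .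
  ultimately obtain n where n: "n \<in> N" "conjugate n ` conjugate g ` P = P"
    using sylow_conjugate_in_subgroup[OF fin p N(1)] by blast
  have nG: "n \<in> carrier G" using n(1) subgroup.mem_carrier[OF N(1)] by blast
  have "conjugate (n \<otimes> g) ` P = P"
    using n(2) conjugate_conjugate[OF nG g(1)] subgroup.mem_carrier[OF PG]
    by (simp add: image_image cong: image_cong)
  then have "n \<otimes> g \<in> normalizer G P"
    using mem_normalizer_iff[OF finP PG] nG g(1) by (metis m_closed order_refl)
  then show ?thesis using that n(1) by blast
qed

lemma (in group) frattini:
  assumes fin: "finite (carrier G)" and p: "Factorial_Ring.prime p" and P: "sylow_subgroup G p P"
    and N: "N \<lhd> G" "normalizer G P \<subseteq> N"
  shows "N = carrier G"
proof
  have NG: "subgroup N G" and c: "\<forall>g\<in>carrier G. conjugate g ` N \<subseteq> N"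
    using N(1) normal_iff_conjugate by blast+
  show "N \<subseteq> carrier G" using NG by (rule subgroup.subset)
  have PG: "subgroup P G" using P by (simp add: sylow_subgroup_def)
  have finP: "finite P" using fin PG finite_subset subgroup.subset by auto
  have PN: "P \<subseteq> N" using subset_normalizer[OF finP PG] N(2) by blast
  show "carrier G \<subseteq> N"
  proof
    fix g assume g: "g \<in> carrier G"
    have "conjugate g ` P \<subseteq> N" using c g PN by blast
    then obtain n where n: "n \<in> N" "n \<otimes> g \<in> normalizer G P"
      using sylow_conjugator_mod_normalizer[OF fin p P NG PN g] by blast
    have nG: "n \<in> carrier G" using n(1) subgroup.mem_carrier[OF NG] by blast
    have "n \<otimes> g \<in> N" using n(2) N(2) by blast
    then have "inv n \<otimes> (n \<otimes> g) \<in> N" using n(1) NG by (simp add: subgroup.m_closed subgroup.m_inv_closed)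
    then show "g \<in> N" using nG g by (simp flip: m_assoc)
  qed
qed

section \<open>Nilpotent groups\<close>

lemma (in group) inv_mult_cancel:
  assumes "x \<in> carrier G" "y \<in> carrier G"
  shows "inv x \<otimes> (x \<otimes> y) = y" "x \<otimes> (inv x \<otimes> y) = y"
  using assms by (simp_all flip: m_assoc)

text \<open>A conjugate of a commutator is the commutator of the conjugates, so normality of one
  term makes the generating set of the next invariant.\<close>

lemma (in group) lower_central_normal: "lower_central G n \<lhd> G"
proof (induction n)
  case 0
  then show ?case by (simp add: normal_self)
next
  case (Suc n)
  let ?S = "{x \<otimes> y \<otimes> inv x \<otimes> inv y | x y. x \<in> lower_central G n \<and> y \<in> carrier G}"
  have sub: "lower_central G n \<subseteq> carrier G"
    using Suc by (meson normal_imp_subgroup subgroup.subset)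
  have c: "conjugate g x \<in> lower_central G n" if "g \<in> carrier G" "x \<in> lower_central G n" for g x
    using Suc that by (simp add: normal_inv_iff)
  have "generate G ?S \<lhd> G"
  proof (rule normal_generateI)
    show "?S \<subseteq> carrier G" using sub by auto
  next
    fix h g assume "h \<in> ?S" and g: "g \<in> carrier G"
    then obtain x y where x: "x \<in> lower_central G n" and y: "y \<in> carrier G"
      and h: "h = x \<otimes> y \<otimes> inv x \<otimes> inv y" by blast
    have xG: "x \<in> carrier G" using sub x by blast
    have "conjugate g h = conjugate g x \<otimes> conjugate g y \<otimes> inv (conjugate g x) \<otimes> inv (conjugate g y)"
      unfolding h conjugate_inv[OF g xG, symmetric] conjugate_inv[OF g y, symmetric]
      using g xG y by (simp only: conjugate_mult m_closed inv_closed)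
    then show "conjugate g h \<in> ?S" using c[OF g x] g y by blast
  qed
  then show ?case by simp
qed

lemma (in group) lower_central_commutator:
  assumes "x \<in> lower_central G n" "y \<in> carrier G"
  shows "x \<otimes> y \<otimes> inv x \<otimes> inv y \<in> lower_central G (Suc n)"
  using assms by (auto intro!: generate.incl)

text \<open>The subgroups \<open>T n\<close> descend from the whole group to \<open>D\<close>. Where
  they first fail to contain \<open>P\<close>, the intersection with \<open>P\<close> gives
  \<open>W\<close>: commutators of \<open>T n\<close> with the group fall into
  \<open>T (Suc n)\<close>. In other words, \<open>P\<close> modulo \<open>W\<close> is a nontrivial
  central section.\<close>

lemma (in group) nilpotent_commutator_subgroup:
  assumes nil: "nilpotent_group G" and P: "P \<lhd> G" and D: "D \<lhd> G" "D \<subset> P"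
  obtains W where "W \<lhd> G" "D \<subseteq> W" "W \<subset> P"
    "\<And>x r. x \<in> P \<Longrightarrow> r \<in> carrier G \<Longrightarrow> x \<otimes> r \<otimes> inv x \<otimes> inv r \<in> W"
proof -
  define T where "T n = lower_central G n <#> D" for n
  have PG: "subgroup P G" and DG: "subgroup D G" using P D normal_imp_subgroup by blast+
  have T: "T n \<lhd> G" for n
    unfolding T_def using lower_central_normal D(1) by (rule normal_subgroup_set_mult_closed)
  have DT: "D \<subseteq> T n" and LT: "lower_central G n \<subseteq> T n" for n
    using subgroup_normal_mult[OF lower_central_normal DG] by (simp_all add: T_def)
  obtain m where "lower_central G m = {\<one>}" using nil by (auto simp: nilpotent_group_def)
  then have "T m = D" using subgroup.mem_carrier[OF DG] by (auto simp: T_def set_mult_def)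
  then have "\<not> P \<subseteq> T m" using D(2) by blast
  moreover have "P \<subseteq> T 0" using LT[of 0] subgroup.subset[OF PG] by auto
  ultimately obtain n where n: "P \<subseteq> T n" "\<not> P \<subseteq> T (Suc n)"
    using ex_least_nat_less[of "\<lambda>n. \<not> P \<subseteq> T n" m] by auto
  define W where "W = P \<inter> T (Suc n)"
  have TG: "subgroup (T (Suc n)) G" using T normal_imp_subgroup by blast
  have WN: "W \<lhd> G"
    unfolding W_def using P T by (rule normal_subgroup_intersect)
  have "D \<subseteq> W" using D(2) DT by (auto simp: W_def)
  moreover have "W \<subset> P" using n(2) by (auto simp: W_def)
  moreover have "x \<otimes> r \<otimes> inv x \<otimes> inv r \<in> W" if x: "x \<in> P" and r: "r \<in> carrier G" for x r
  proof -
    have xG: "x \<in> carrier G" using x subgroup.mem_carrier[OF PG] by blast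
    have "conjugate r (inv x) \<in> P"
      using P r x PG by (simp add: normal_inv_iff subgroup.m_inv_closed)
    then have "x \<otimes> conjugate r (inv x) \<in> P" using x PG by (simp add: subgroup.m_closed)
    then have inP: "x \<otimes> r \<otimes> inv x \<otimes> inv r \<in> P" using xG r by (simp add: m_assoc)
    obtain c d where c: "c \<in> lower_central G n" and d: "d \<in> D" and xcd: "x = c \<otimes> d"
      using n(1) x by (auto simp: T_def set_mult_def)
    have cG: "c \<in> carrier G"
      using subgroup.mem_carrier[OF normal_imp_subgroup[OF lower_central_normal] c] .
    have dG: "d \<in> carrier G" using d subgroup.mem_carrier[OF DG] by blast
    have "conjugate r (inv d) \<in> D"
      using D(1) r d DG by (simp add: normal_inv_iff subgroup.m_inv_closed)
    then have "d \<otimes> conjugate r (inv d) \<in> D" using d DG by (simp add: subgroup.m_closed)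
    then have 1: "conjugate c (d \<otimes> conjugate r (inv d)) \<in> T (Suc n)"
      using D(1) cG DT by (auto simp: normal_inv_iff)
    have 2: "c \<otimes> r \<otimes> inv c \<otimes> inv r \<in> T (Suc n)"
      using lower_central_commutator[OF c r] LT by blast
    \<comment> \<open>The identity [cd,r] = c[d,r]c^-1 [c,r]. The first factor lies in
      \<open>D\<close> because \<open>D\<close> is normal, the second in the next term of the lower
      central series.\<close>
    have "x \<otimes> r \<otimes> inv x \<otimes> inv r = conjugate c (d \<otimes> conjugate r (inv d)) \<otimes> (c \<otimes> r \<otimes> inv c \<otimes> inv r)"
      unfolding xcd using cG dG r by (simp add: m_assoc inv_mult_group inv_mult_cancel)
    then show ?thesis using inP subgroup.m_closed[OF TG 1 2] by (simp add: W_def)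
  qed
  ultimately show ?thesis using that WN by blast
qed

text \<open>Take the last term of the lower central series before the series drops into
  \<open>R\<close>. An \<open>x\<close> in it outside \<open>R\<close> has all its commutators in
  \<open>R\<close>, so it normalizes \<open>R\<close>.\<close>

lemma (in group) nilpotent_normalizer_grows:
  assumes fin: "finite (carrier G)" and nil: "nilpotent_group G" and R: "subgroup R G" "R \<noteq> carrier G"
  obtains x where "x \<in> carrier G" "x \<notin> R" "x \<in> normalizer G R"
proof -
  have RG: "R \<subseteq> carrier G" using R(1) by (rule subgroup.subset)
  obtain m where "lower_central G m = {\<one>}" using nil by (auto simp: nilpotent_group_def)
  then have "lower_central G m \<subseteq> R" using subgroup.one_closed[OF R(1)] by simp
  moreover have "\<not> lower_central G 0 \<subseteq> R" using R(2) RG by auto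
  ultimately obtain n where n: "\<not> lower_central G n \<subseteq> R" "lower_central G (Suc n) \<subseteq> R"
    using ex_least_nat_less[of "\<lambda>n. lower_central G n \<subseteq> R" m] by blast
  then obtain x where x: "x \<in> lower_central G n" "x \<notin> R" by blast
  have xG: "x \<in> carrier G"
    using subgroup.mem_carrier[OF normal_imp_subgroup[OF lower_central_normal] x(1)] .
  have "conjugate x r \<in> R" if r: "r \<in> R" for r
  proof -
    have rG: "r \<in> carrier G" using r RG by blast
    have "x \<otimes> r \<otimes> inv x \<otimes> inv r \<in> R" using lower_central_commutator[OF x(1) rG] n(2) by blast
    then have "x \<otimes> r \<otimes> inv x \<otimes> inv r \<otimes> r \<in> R" using r R(1) by (simp add: subgroup.m_closed)
    then show ?thesis using xG rG by (simp add: m_assoc)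
  qed
  then have "x \<in> normalizer G R"
    using mem_normalizer_iff[OF _ R(1)] fin RG xG finite_subset by blast
  then show ?thesis using that x(2) xG by blast
qed

text \<open>The normalizer of a Sylow subgroup is its own normalizer, which a proper subgroup of a
  nilpotent group cannot be.\<close>

lemma (in group) nilpotent_sylow_normal:
  assumes fin: "finite (carrier G)" and nil: "nilpotent_group G" and p: "Factorial_Ring.prime p"
    and P: "sylow_subgroup G p P"
  shows "P \<lhd> G"
proof -
  have PG: "subgroup P G" using P by (simp add: sylow_subgroup_def)
  have finP: "finite P" using fin PG finite_subset subgroup.subset by auto
  let ?N = "normalizer G P"
  have NG: "subgroup ?N G" using PG by (rule subgroup_normalizer)
  have finN: "finite ?N" using fin NG finite_subset subgroup.subset by auto
  have PN: "P \<subseteq> ?N" using subset_normalizer[OF finP PG] .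
  have "?N = carrier G"
  proof (rule ccontr)
    assume "?N \<noteq> carrier G"
    then obtain x where x: "x \<in> carrier G" "x \<notin> ?N" "x \<in> normalizer G ?N"
      using nilpotent_normalizer_grows[OF fin nil NG] by blast
    have "conjugate x ` P \<subseteq> ?N"
      using x(3) mem_normalizer_iff[OF finN NG] PN by blast
    then obtain n where n: "n \<in> ?N" "n \<otimes> x \<in> ?N"
      using sylow_conjugator_mod_normalizer[OF fin p P NG PN x(1)] by blast
    then have "inv n \<otimes> (n \<otimes> x) \<in> ?N" using NG by (simp add: subgroup.m_closed subgroup.m_inv_closed)
    moreover have "n \<in> carrier G" using n(1) subgroup.mem_carrier[OF NG] by blast
    ultimately show False using x(1,2) by (simp flip: m_assoc)
  qed
  then show ?thesis using normal_iff_normalizer[OF finP PG] by blast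
qed

text \<open>The commutator of \<open>y\<close> and \<open>x\<close> lies in both normal subgroups,
  hence is trivial.\<close>

lemma (in group) normal_disjoint_commute:
  assumes "P \<lhd> G" "Q \<lhd> G" "P \<inter> Q = {\<one>}" "x \<in> P" "y \<in> Q"
  shows "conjugate y x = x"
proof -
  have PG: "subgroup P G" and QG: "subgroup Q G" using assms normal_imp_subgroup by blast+
  have xG: "x \<in> carrier G" and yG: "y \<in> carrier G"
    using assms subgroup.mem_carrier[OF PG] subgroup.mem_carrier[OF QG] by blast+
  have "conjugate y x \<otimes> inv x \<in> P"
    using assms(1,4) yG PG by (simp add: normal_inv_iff subgroup.m_closed subgroup.m_inv_closed)
  moreover have "conjugate x (inv y) \<in> Q"
    using assms(2,5) xG QG by (simp add: normal_inv_iff subgroup.m_inv_closed)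
  then have "y \<otimes> conjugate x (inv y) \<in> Q" using assms(5) QG by (simp add: subgroup.m_closed)
  then have "conjugate y x \<otimes> inv x \<in> Q" using xG yG by (simp add: m_assoc)
  ultimately have "conjugate y x \<otimes> inv x = \<one>" using assms(3) by blast
  then show ?thesis using xG yG inv_solve_right[of \<one> "conjugate y x" x] by simp
qed

lemma (in group) coprime_subgroups_disjoint:
  assumes fin: "finite (carrier G)" and P: "subgroup P G" and Q: "subgroup Q G"
    and "coprime (card P) (card Q)"
  shows "P \<inter> Q = {\<one>}"
proof -
  have "card (P \<inter> Q) dvd card P" "card (P \<inter> Q) dvd card Q"
    using card_subgroup_dvd subgroups_Inter_pair P Q by (metis inf.cobounded1 inf.cobounded2)+
  then have "card (P \<inter> Q) = 1" using assms(4) coprime_common_divisor_nat by blast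
  moreover have "\<one> \<in> P \<inter> Q" using P Q subgroup.one_closed by blast
  ultimately show ?thesis by (metis card_1_singletonE singletonD)
qed

section \<open>Transfer\<close>

text \<open>The argument of \<open>l\<close> is the element of \<open>P\<close> by which
  \<open>r C \<otimes> g\<close> differs from the representative chosen for the coset
  \<open>C #> g\<close>. The homomorphism \<open>l\<close> is part of the definition so that its
  target can be any abelian group, later a quotient of \<open>P\<close>.\<close>

definition (in group) transfer :: "('c, 'd) monoid_scheme \<Rightarrow> 'a set \<Rightarrow> ('a \<Rightarrow> 'c) \<Rightarrow> ('a set \<Rightarrow> 'a) \<Rightarrow> 'a \<Rightarrow> 'c"
  where "transfer A P l r g = finprod A (\<lambda>C. l (r C \<otimes> g \<otimes> inv (r (C #> g)))) (rcosets P)"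

lemma (in group) transversal_diff_in_subgroup:
  assumes P: "subgroup P G" and r: "\<And>C. C \<in> rcosets P \<Longrightarrow> r C \<in> C"
    and C: "C \<in> rcosets P" and g: "g \<in> carrier G"
  shows "r C \<otimes> g \<otimes> inv (r (C #> g)) \<in> P"
proof -
  have "C #> g \<in> rcosets P" using P C g by (rule rcos_mult_closed)
  moreover have "r C \<otimes> g \<in> C #> g" using r[OF C] by (auto simp: r_coset_def)
  ultimately show ?thesis using diff_neutralizes[OF P] r by blast
qed

text \<open>The factors satisfy the cocycle rule a(gh,C) = a(g,C) a(h,Cg). Since \<open>A\<close> is
  abelian, the product splits, and in the second part \<open>g\<close> merely permutes the
  cosets.\<close>

lemma (in group) transfer_hom:
  assumes P: "subgroup P G" and A: "comm_group A" and l: "l \<in> hom (G\<lparr>carrier := P\<rparr>) A"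
    and r: "\<And>C. C \<in> rcosets P \<Longrightarrow> r C \<in> C"
  shows "transfer A P l r \<in> hom G A"
proof (rule homI)
  interpret A: comm_group A by fact
  let ?a = "\<lambda>g C. r C \<otimes> g \<otimes> inv (r (C #> g))"
  have aP: "?a g C \<in> P" if "C \<in> rcosets P" "g \<in> carrier G" for C g
    using transversal_diff_in_subgroup[OF P r] that by blast
  have lA: "l x \<in> carrier A" if "x \<in> P" for x using hom_in_carrier[OF l] that by simp
  have la: "l (?a g C) \<in> carrier A" if "C \<in> rcosets P" "g \<in> carrier G" for C g
    using lA aP that by blast
  show "transfer A P l r g \<in> carrier A" if "g \<in> carrier G" for g
    unfolding transfer_def using la that by (intro A.finprod_closed) auto
  show "transfer A P l r (g \<otimes> h) = transfer A P l r g \<otimes>\<^bsub>A\<^esub> transfer A P l r h"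
    if g: "g \<in> carrier G" and h: "h \<in> carrier G" for g h
  proof -
    have step: "l (?a (g \<otimes> h) C) = l (?a g C) \<otimes>\<^bsub>A\<^esub> l (?a h (C #> g))" if C: "C \<in> rcosets P" for C
    proof -
      have Cg: "C #> g \<in> rcosets P" using P C g by (rule rcos_mult_closed)
      have Cgh: "C #> g #> h = C #> (g \<otimes> h)" using P C g h by (rule rcos_mult_mult)
      have rG: "r E \<in> carrier G" if "E \<in> rcosets P" for E
        using r[OF that] subgroup.rcosets_carrier[OF P is_group that] by blast
      have "?a (g \<otimes> h) C = ?a g C \<otimes> ?a h (C #> g)"
        unfolding Cgh using rG[OF C] rG[OF Cg] rG[OF rcos_mult_closed[OF P C m_closed[OF g h]]] g h
        by (simp add: m_assoc inv_mult_cancel)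
      then show ?thesis
        using hom_mult[OF l, of "?a g C" "?a h (C #> g)"] aP[OF C g] aP[OF Cg h] by simp
    qed
    have "transfer A P l r (g \<otimes> h)
        = finprod A (\<lambda>C. l (?a g C) \<otimes>\<^bsub>A\<^esub> l (?a h (C #> g))) (rcosets P)"
      unfolding transfer_def
      by (intro A.finprod_cong')
        (use step la g h rcos_mult_closed[OF P _ g] in \<open>auto simp del: m_assoc\<close>)
    also have "\<dots> = transfer A P l r g \<otimes>\<^bsub>A\<^esub> finprod A (\<lambda>C. l (?a h (C #> g))) (rcosets P)"
      unfolding transfer_def
      by (intro A.finprod_multf) (use la g h rcos_mult_closed[OF P _ g] in blast)+
    also have "finprod A (\<lambda>C. l (?a h (C #> g))) (rcosets P)
        = finprod A (\<lambda>C. l (?a h C)) ((\<lambda>C. C #> g) ` (rcosets P))"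
      using bij_betw_rcos_mult[OF P g] rcos_mult_closed[OF P _ g] la[OF _ h]
      by (intro A.finprod_reindex[symmetric]) (auto simp: bij_betw_def)
    also have "(\<lambda>C. C #> g) ` (rcosets P) = rcosets P"
      using bij_betw_rcos_mult[OF P g] by (simp add: bij_betw_def)
    finally show ?thesis by (simp add: transfer_def)
  qed
qed

lemma (in group_hom) card_image_mult_card_kernel:
  "card (h ` carrier G) * card (kernel G H h) = order G"
proof -
  \<comment> \<open>Shrinking the codomain to the image makes \<open>h\<close> surjective, as the
    first isomorphism theorem requires.\<close>
  interpret im: group_hom G "H\<lparr>carrier := h ` carrier G\<rparr>" h
    using H.subgroup_imp_group[OF img_is_subgroup] homh
    by (auto simp: group_hom_def group_hom_axioms_def hom_def)
  have "G Mod kernel G H h \<cong> H\<lparr>carrier := h ` carrier G\<rparr>"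
    using im.FactGroup_iso by (simp add: kernel_def)
  then have "card (rcosets (kernel G H h)) = card (h ` carrier G)"
    using iso_same_card by (fastforce simp: FactGroup_def)
  then show ?thesis using G.lagrange[OF subgroup_kernel] by simp
qed

text \<open>The representative of a right coset \<open>C\<close> is chosen as \<open>t C \<otimes> u C\<close>, where \<open>t C\<close> depends only on
  the double coset of \<open>C\<close>; this makes the transfer explicit on \<open>P\<close>.\<close>

lemma (in group) double_coset_transversal:
  assumes P: "subgroup P G"
  obtains t u where "\<And>C. C \<in> rcosets P \<Longrightarrow> t C \<in> carrier G" "\<And>C. C \<in> rcosets P \<Longrightarrow> u C \<in> P"
    "\<And>C. C \<in> rcosets P \<Longrightarrow> t C \<otimes> u C \<in> C"
    "\<And>C x. C \<in> rcosets P \<Longrightarrow> x \<in> P \<Longrightarrow> t (C #> x) = t C"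
proof -
  define t where "t C = (SOME t. t \<in> C <#> P)" for C
  define u where "u C = (SOME u. u \<in> P \<and> t C \<otimes> u \<in> C)" for C
  have PG: "x \<in> carrier G" if "x \<in> P" for x using that subgroup.mem_carrier[OF P] by blast
  have CG: "c \<in> carrier G" if "C \<in> rcosets P" "c \<in> C" for C c
    using subgroup.rcosets_carrier[OF P is_group that(1)] that(2) by blast
  have tC: "t C \<in> C <#> P" if C: "C \<in> rcosets P" for C
  proof -
    obtain c where "c \<in> C" using subgroup.rcosets_non_empty[OF P C] by blast
    then have "c \<otimes> \<one> \<in> C <#> P" using subgroup.one_closed[OF P] by (auto simp: set_mult_def)
    then show ?thesis unfolding t_def by (rule someI)
  qed
  have tG: "t C \<in> carrier G" if C: "C \<in> rcosets P" for C
    using tC[OF C] CG[OF C] PG by (auto simp: set_mult_def)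
  have uC: "u C \<in> P \<and> t C \<otimes> u C \<in> C" if C: "C \<in> rcosets P" for C
  proof -
    obtain c q where c: "c \<in> C" "q \<in> P" "t C = c \<otimes> q" using tC[OF C] by (auto simp: set_mult_def)
    then have "inv q \<in> P \<and> t C \<otimes> inv q \<in> C"
      using CG[OF C] PG subgroup.m_inv_closed[OF P] by (simp add: m_assoc)
    then show ?thesis unfolding u_def by (rule someI)
  qed
  have "t (C #> x) = t C" if C: "C \<in> rcosets P" and x: "x \<in> P" for C x
  proof -
    \<comment> \<open>The choice of \<open>t C\<close> is made from \<open>C <#> P\<close> only, and
      this set does not change when \<open>C\<close> is multiplied by an element of
      \<open>P\<close>.\<close>
    have "(C #> x) <#> P = C <#> (x <# P)"
      using rcos_assoc_lcos[of C P x] subgroup.rcosets_carrier[OF P is_group C] subgroup.subset[OF P] PG[OF x]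
      by simp
    also have "x <# P = P"
      using P x PG[OF x] coset_join3 by blast
    finally show ?thesis by (simp add: t_def)
  qed
  then show ?thesis using that tG uC by blast
qed

text \<open>For \<open>x\<close> in \<open>P\<close>, a coset fixed by \<open>P\<close> has its
  representative in the normalizer and contributes \<open>l x\<close> by \<open>inv_l\<close>. Every
  other coset contributes the value of \<open>l\<close> at a conjugate by an element outside the
  normalizer, which \<open>triv\<close> makes trivial. What remains is a power of
  \<open>l x\<close>.\<close>

lemma (in group) transfer_on_trivial_intersection:
  assumes fin: "finite (carrier G)" and P: "subgroup P G" and A: "comm_group A"
    and l: "l \<in> hom (G\<lparr>carrier := P\<rparr>) A"
    and inv_l: "\<And>g x. g \<in> normalizer G P \<Longrightarrow> x \<in> P \<Longrightarrow> l (conjugate g x) = l x"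
    and triv: "\<And>g x. g \<in> carrier G \<Longrightarrow> g \<notin> normalizer G P \<Longrightarrow> x \<in> P \<Longrightarrow> conjugate g x \<in> P
      \<Longrightarrow> l (conjugate g x) = \<one>\<^bsub>A\<^esub>"
  obtains V where "V \<in> hom G A"
    "\<And>x. x \<in> P \<Longrightarrow> V x = l x [^]\<^bsub>A\<^esub> card {C\<in>rcosets P. \<forall>x\<in>P. C #> x = C}"
proof -
  interpret A: comm_group A by fact
  let ?F = "{C\<in>rcosets P. \<forall>x\<in>P. C #> x = C}"
  have finP: "finite P" using fin P finite_subset subgroup.subset by auto
  obtain t u where tG: "\<And>C. C \<in> rcosets P \<Longrightarrow> t C \<in> carrier G"
    and uP: "\<And>C. C \<in> rcosets P \<Longrightarrow> u C \<in> P"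
    and tu: "\<And>C. C \<in> rcosets P \<Longrightarrow> t C \<otimes> u C \<in> C"
    and tx: "\<And>C x. C \<in> rcosets P \<Longrightarrow> x \<in> P \<Longrightarrow> t (C #> x) = t C"
    using double_coset_transversal[OF P] by metis
  define r where "r C = t C \<otimes> u C" for C
  have rC: "r C \<in> C" if "C \<in> rcosets P" for C using tu[OF that] by (simp add: r_def)
  have PG: "x \<in> carrier G" if "x \<in> P" for x using that subgroup.mem_carrier[OF P] by blast
  have rG: "r C \<in> carrier G" if "C \<in> rcosets P" for C using tG uP PG that by (simp add: r_def)
  have lA: "l x \<in> carrier A" if "x \<in> P" for x using hom_in_carrier[OF l] that by simp
  have NG: "subgroup (normalizer G P) G" using P by (rule subgroup_normalizer)
  have PN: "P \<subseteq> normalizer G P" using finP P by (rule subset_normalizer)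
  have fixed: "C \<in> ?F \<longleftrightarrow> r C \<in> normalizer G P" if C: "C \<in> rcosets P" for C
  proof -
    have "C = P #> r C"
      using C rC[OF C] repr_independence P by (auto simp: RCOSETS_def)
    then have "C \<in> ?F \<longleftrightarrow> (\<forall>x\<in>P. conjugate (r C) x \<in> P)"
      using C rcos_fixed_iff[OF P rG[OF C]] PG by auto
    then show ?thesis using mem_normalizer_iff[OF finP P] rG[OF C] by auto
  qed
  have val: "l (r C \<otimes> x \<otimes> inv (r (C #> x))) = (if C \<in> ?F then l x else \<one>\<^bsub>A\<^esub>)"
    if C: "C \<in> rcosets P" and x: "x \<in> P" for C x
  proof (cases "C \<in> ?F")
    case True
    then have "C #> x = C" using x by blast
    then show ?thesis using True inv_l[of "r C" x] fixed[OF C] x by simp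
  next
    case False
    have Cx: "C #> x \<in> rcosets P" using P C PG[OF x] by (rule rcos_mult_closed)
    \<comment> \<open>Since \<open>C\<close> and \<open>C #> x\<close> share the same
      \<open>t\<close>, the transfer factor is a genuine conjugate by \<open>t C\<close> of an
      element \<open>y\<close> of \<open>P\<close>.\<close>
    define y where "y = u C \<otimes> x \<otimes> inv (u (C #> x))"
    have y: "y \<in> P"
      using uP[OF C] uP[OF Cx] x P by (simp add: y_def subgroup.m_closed subgroup.m_inv_closed)
    have eq: "r C \<otimes> x \<otimes> inv (r (C #> x)) = conjugate (t C) y"
      unfolding r_def y_def tx[OF C x]
      using tG[OF C] PG[OF uP[OF C]] PG[OF uP[OF Cx]] PG[OF x] by (simp add: m_assoc inv_mult_group)
    have "t C \<notin> normalizer G P"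
    proof
      assume "t C \<in> normalizer G P"
      then have "r C \<in> normalizer G P"
        using uP[OF C] PN NG by (auto simp: r_def subgroup.m_closed)
      then show False using False fixed[OF C] by blast
    qed
    moreover have "conjugate (t C) y \<in> P"
      using transversal_diff_in_subgroup[OF P rC C PG[OF x]] by (simp add: eq)
    ultimately have "l (conjugate (t C) y) = \<one>\<^bsub>A\<^esub>" using triv[OF tG[OF C] _ y] by blast
    then show ?thesis using False unfolding eq by (simp only: if_False)
  qed
  have finR: "finite (rcosets P)" using fin P by (meson finite_Pow_iff finite_subset rcosets_subset_PowG)
  have "transfer A P l r x = l x [^]\<^bsub>A\<^esub> card ?F" if x: "x \<in> P" for x
  proof -
    have "transfer A P l r x = finprod A (\<lambda>C. l x) ?F"
      unfolding transfer_def using finR val[OF _ x] lA[OF x]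
      by (intro A.finprod_mono_neutral_cong_right) auto
    then show ?thesis using A.finprod_const[OF lA[OF x]] by simp
  qed
  then show ?thesis using that transfer_hom[OF P A l rC] by blast
qed

lemma (in group) pow_coprime_order_eq_one:
  assumes "a \<in> carrier G" "coprime m (order G)" "a [^] m = \<one>"
  shows "a = \<one>"
proof -
  have "ord a dvd m" using assms pow_eq_id by blast
  moreover have "ord a dvd order G" using assms(1) pow_order_eq_1 pow_eq_id by blast
  ultimately have "ord a = 1" using assms(2) coprime_common_divisor_nat by blast
  then show ?thesis using assms(1) ord_eq_1 by blast
qed

text \<open>The target of the transfer is \<open>P\<close> modulo \<open>W\<close>. As
  \<open>W\<close> contains the commutators of \<open>P\<close> with its normalizer, this quotient
  is abelian and the normalizer acts trivially on it; conjugates by other elements meet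
  \<open>P\<close> only inside \<open>D\<close>, which dies in the quotient. The kernel of the
  transfer is the required \<open>K\<close>.\<close>

lemma (in group) p_quotient_by_transfer:
  assumes fin: "finite (carrier G)" and p: "Factorial_Ring.prime p" and P: "sylow_subgroup G p P"
    and D: "D \<lhd> G" "D \<subseteq> W" and W: "subgroup W G" "W \<subset> P"
    and comm: "\<And>x g. x \<in> P \<Longrightarrow> g \<in> normalizer G P \<Longrightarrow> x \<otimes> g \<otimes> inv x \<otimes> inv g \<in> W"
    and triv: "\<And>g. g \<in> carrier G \<Longrightarrow> g \<notin> normalizer G P \<Longrightarrow> P \<inter> conjugate g ` P \<subseteq> D"
  obtains K k where "K \<lhd> G" "D \<subseteq> K" "K \<noteq> carrier G" "order G = p ^ k * card K"
proof -
  have PG: "subgroup P G" and cP: "card P = p ^ multiplicity p (order G)"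
    using P by (simp_all add: sylow_subgroup_def)
  have finP: "finite P" using fin PG finite_subset subgroup.subset by auto
  have NG: "subgroup (normalizer G P) G" using PG by (rule subgroup_normalizer)
  have PN: "P \<subseteq> normalizer G P" using finP PG by (rule subset_normalizer)
  have Pc: "x \<in> carrier G" if "x \<in> P" for x using that subgroup.mem_carrier[OF PG] by blast
  have Nc: "x \<in> carrier G" if "x \<in> normalizer G P" for x using that subgroup.mem_carrier[OF NG] by blast
  have Wabs: "W #> (w \<otimes> y) = W #> y" if "w \<in> W" "y \<in> carrier G" for w y
    using that repr_independence[OF _ _ W(1)] rcosI[OF _ subgroup.subset[OF W(1)]] by metis
  have conjP: "conjugate g x \<in> P" if "g \<in> normalizer G P" "x \<in> P" for g x
    using that mem_normalizer_iff[OF finP PG] by blast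
  have diff: "conjugate g x \<otimes> inv x \<in> W" if g: "g \<in> normalizer G P" and x: "x \<in> P" for g x
  proof -
    have "inv (x \<otimes> g \<otimes> inv x \<otimes> inv g) \<in> W"
      using comm[OF x g] W(1) by (simp add: subgroup.m_inv_closed)
    moreover have "inv (x \<otimes> g \<otimes> inv x \<otimes> inv g) = conjugate g x \<otimes> inv x"
      using Pc[OF x] Nc[OF g] by (simp add: m_assoc inv_mult_group)
    ultimately show ?thesis by simp
  qed
  have conj_eq: "W #> conjugate g x = W #> x" if g: "g \<in> normalizer G P" and x: "x \<in> P" for g x
    using Wabs[OF diff[OF g x] Pc[OF x]] Pc[OF x] Nc[OF g] by (simp add: m_assoc)
  have WP: "W \<lhd> G\<lparr>carrier := P\<rparr>"
  proof -
    have "conjugate g w \<in> W" if g: "g \<in> P" and w: "w \<in> W" for g w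
    proof -
      have "conjugate g w \<otimes> inv w \<otimes> w \<in> W"
        using diff[of g w] g w PN W(2) subgroup.m_closed[OF W(1)] by blast
      then show ?thesis using Pc[OF g] subgroup.mem_carrier[OF W(1) w] by (simp add: m_assoc)
    qed
    then show ?thesis using W unfolding normal_restrict_iff[OF PG] by blast
  qed
  define A where "A = G\<lparr>carrier := P\<rparr> Mod W"
  define l where "l x = W #> x" for x
  have l: "l \<in> hom (G\<lparr>carrier := P\<rparr>) A"
    using normal.r_coset_hom_Mod[OF WP] by (simp add: A_def l_def[abs_def])
  have carA: "carrier A = l ` P" by (auto simp: A_def FactGroup_def RCOSETS_def l_def)
  have lm: "l (x \<otimes> y) = l x \<otimes>\<^bsub>A\<^esub> l y" if "x \<in> P" "y \<in> P" for x y
    using hom_mult[OF l] that by simp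
  interpret Ag: group A unfolding A_def using WP by (rule normal.factorgroup_is_group)
  have l_conj: "l (conjugate g x) = l x" if "g \<in> normalizer G P" "x \<in> P" for g x
    using conj_eq that by (simp add: l_def)
  have A: "comm_group A"
  proof (rule Ag.group_comm_groupI)
    fix a b assume "a \<in> carrier A" "b \<in> carrier A"
    then obtain x y where x: "x \<in> P" "a = l x" and y: "y \<in> P" "b = l y" using carA by auto
    \<comment> \<open>Write xy as (xyx^-1)x; modulo \<open>W\<close> the conjugate is
      \<open>y\<close> again.\<close>
    have "a \<otimes>\<^bsub>A\<^esub> b = l (conjugate x y \<otimes> x)"
      using lm[OF x(1) y(1)] x y Pc by (simp add: m_assoc)
    also have "\<dots> = b \<otimes>\<^bsub>A\<^esub> a"
      using lm[OF conjP x(1)] l_conj x y PN by auto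
    finally show "a \<otimes>\<^bsub>A\<^esub> b = b \<otimes>\<^bsub>A\<^esub> a" .
  qed
  have l_one: "l x = \<one>\<^bsub>A\<^esub> \<longleftrightarrow> x \<in> W" if "x \<in> P" for x
    using coset_join1[OF _ Pc[OF that] W(1)] coset_join2[OF Pc[OF that] W(1)] subgroup.subset[OF W(1)]
    by (auto simp: l_def A_def)
  have l_triv: "l (conjugate g x) = \<one>\<^bsub>A\<^esub>"
    if "g \<in> carrier G" "g \<notin> normalizer G P" "x \<in> P" "conjugate g x \<in> P" for g x
    using that triv[of g] D(2) l_one by blast
  obtain V where V: "V \<in> hom G A"
    and VP: "\<And>x. x \<in> P \<Longrightarrow> V x = l x [^]\<^bsub>A\<^esub> card {C\<in>rcosets P. \<forall>x\<in>P. C #> x = C}"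
    using transfer_on_trivial_intersection[OF fin PG A l l_conj l_triv] by blast
  let ?m = "card {C\<in>rcosets P. \<forall>x\<in>P. C #> x = C}"
  \<comment> \<open>The number of cosets fixed by \<open>P\<close> is congruent modulo
    \<open>p\<close> to the index of \<open>P\<close>.\<close>
  have m: "\<not> p dvd ?m"
    using card_fixed_rcosets_mod[OF fin p PG PG cP] sylow_index_not_dvd[OF fin p P]
    by (simp add: dvd_eq_mod_eq_0)
  have cA: "order A dvd card P"
    using group.lagrange[OF subgroup_imp_group[OF PG] normal_imp_subgroup[OF WP]]
    by (simp add: A_def FactGroup_def order_def) (metis dvd_triv_left)
  have "coprime p ?m" using p m by (rule prime_imp_coprime)
  then have "coprime ?m (p ^ multiplicity p (order G))"
    by (simp add: coprime_commute)
  then have cop: "coprime ?m (order A)"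
    by (rule coprime_divisors[OF dvd_refl cA[unfolded cP]])
  interpret Vh: group_hom G A V
    using V by (simp add: group_hom_def group_hom_axioms_def Ag.group_axioms)
  define K where "K = kernel G A V"
  have K: "K \<lhd> G" unfolding K_def by (rule Vh.normal_kernel)
  have "D \<subseteq> K"
  proof
    fix d assume d: "d \<in> D"
    then have "d \<in> P" "l d = \<one>\<^bsub>A\<^esub>" using D(2) W(2) l_one by auto
    then show "d \<in> K" using VP[of d] Pc by (simp add: K_def kernel_def)
  qed
  moreover have "K \<noteq> carrier G"
  proof
    assume KG: "K = carrier G"
    \<comment> \<open>On such an \<open>x\<close> the transfer is the power of \<open>l x\<close>
      with exponent prime to the order of \<open>A\<close>; if it were trivial, \<open>x\<close>
      would lie in \<open>W\<close>.\<close>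
    obtain x where x: "x \<in> P" "x \<notin> W" using W(2) by blast
    have "V x = \<one>\<^bsub>A\<^esub>" using KG Pc[OF x(1)] by (auto simp: K_def kernel_def)
    then have "l x = \<one>\<^bsub>A\<^esub>"
      using VP[OF x(1)] Ag.pow_coprime_order_eq_one[OF _ cop] carA x(1) by auto
    then show False using l_one x by blast
  qed
  moreover obtain k where "card (V ` carrier G) = p ^ k"
  proof -
    have "card (V ` carrier G) dvd p ^ multiplicity p (order G)"
      using Ag.card_subgroup_dvd_order[OF Vh.img_is_subgroup] cA cP dvd_trans by metis
    then show ?thesis using p divides_primepow_nat that by blast
  qed
  ultimately show ?thesis using that K Vh.card_image_mult_card_kernel by (metis K_def)
qed

section \<open>Quotients of prime power order\<close>

lemma (in group) maximal_subgroup_above: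
  assumes fin: "finite (carrier G)" and H: "subgroup H G" "H \<noteq> carrier G"
  obtains M where "maximal_subgroup M G" "H \<subseteq> M"
proof -
  let ?Q = "\<lambda>M. subgroup M G \<and> M \<noteq> carrier G \<and> H \<subseteq> M"
  have le: "card M \<le> order G" if "subgroup M G" for M
    using fin subgroup.subset[OF that] by (simp add: order_def card_mono)
  then have "\<exists>M. ?Q M \<and> (\<forall>N. ?Q N \<longrightarrow> card N \<le> card M)"
    using H by (intro ex_has_greatest_nat[of ?Q H card "Suc (order G)"]) (simp_all add: less_Suc_eq_le)
  then obtain M where M: "?Q M" "\<And>N. ?Q N \<Longrightarrow> card N \<le> card M" by metis
  have "N = M \<or> N = carrier G" if N: "subgroup N G" "M \<subseteq> N" for N
  proof (rule ccontr)
    assume "\<not> ?thesis"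
    then have "card N \<le> card M" "N \<noteq> M" using M N by blast+
    moreover have "finite N" using finite_subset[OF subgroup.subset[OF N(1)] fin] .
    ultimately show False using card_seteq[of N M] N(2) by simp
  qed
  then have "maximal_subgroup M G" using M(1) by (simp add: maximal_subgroup_def)
  then show ?thesis using that[of M] M(1) by simp
qed

lemma (in group) card_subgroup_of_p_group:
  assumes "Factorial_Ring.prime p" "subgroup P G" "card P = p ^ k" "subgroup Q G" "Q \<subseteq> P"
  obtains i where "card Q = p ^ i"
proof -
  have "card Q dvd p ^ k" using card_subgroup_dvd[of Q P] assms by simp
  then show ?thesis using that divides_primepow_nat[OF assms(1)] by blast
qed

lemma (in group) p_subgroup_in_normal_sylow:
  assumes fin: "finite (carrier G)" and p: "Factorial_Ring.prime p" and P: "sylow_subgroup G p P" "P \<lhd> G"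
    and Q: "subgroup Q G" "card Q = p ^ k"
  shows "Q \<subseteq> P"
proof
  fix x assume x: "x \<in> Q"
  obtain g where g: "g \<in> carrier G" "conjugate g ` Q \<subseteq> P"
    using sylow_contains_conjugate[OF fin p P(1) Q] .
  then have "conjugate (inv g) (conjugate g x) \<in> P"
    using P(2) x unfolding normal_inv_iff by blast
  then show "x \<in> P"
    using conjugate_inv_cancel(1)[OF g(1) subgroup.mem_carrier[OF Q(1) x]] by simp
qed

lemma (in group) prime_dvd_card_sylow:
  assumes "Factorial_Ring.prime p" "sylow_subgroup G p P" "P \<noteq> {\<one>}"
  shows "p dvd card P"
proof (rule ccontr)
  assume "\<not> p dvd card P"
  then have "multiplicity p (order G) = 0"
    using card_sylow[OF assms(2)] by (metis dvd_power gr0I)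
  then have "card P = 1" using card_sylow[OF assms(2)] by simp
  moreover have "\<one> \<in> P" using assms(2) subgroup.one_closed by (auto simp: sylow_subgroup_def)
  ultimately show False using assms(3) by (metis card_1_singletonE singletonD)
qed

text \<open>The hypothesis on maximal subgroups with the prime as a parameter, because the prime
  changes both within one group and on passing to a quotient.\<close>

definition nilpotent_normal_or_prime_to :: "nat \<Rightarrow> ('a, 'b) monoid_scheme \<Rightarrow> bool"
  where "nilpotent_normal_or_prime_to p G \<longleftrightarrow> (\<forall>M. maximal_subgroup M G \<longrightarrow>
    nilpotent_group (G\<lparr>carrier := M\<rparr>) \<or> M \<lhd> G \<or> \<not> p dvd card M)"

text \<open>A maximal subgroup \<open>M\<close> above the normalizer is not normal, by Frattini, and
  has order divisible by \<open>p\<close>; so it is nilpotent. Then \<open>P\<close> is normal in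
  \<open>M\<close>, which forces \<open>M\<close> down into the normalizer.\<close>

lemma (in group) sylow_normalizer_maximal:
  assumes fin: "finite (carrier G)" and p: "Factorial_Ring.prime p"
    and max: "nilpotent_normal_or_prime_to p G"
    and P: "sylow_subgroup G p P" "\<not> P \<lhd> G"
  shows "maximal_subgroup (normalizer G P) G" "nilpotent_group (G\<lparr>carrier := normalizer G P\<rparr>)"
    "\<not> normalizer G P \<lhd> G"
proof -
  have PG: "subgroup P G" using P by (simp add: sylow_subgroup_def)
  have finP: "finite P" using fin PG finite_subset subgroup.subset by auto
  have NG: "subgroup (normalizer G P) G" using PG by (rule subgroup_normalizer)
  have "normalizer G P \<noteq> carrier G" using P(2) normal_iff_normalizer[OF finP PG] by blast
  then obtain M where M: "maximal_subgroup M G" "normalizer G P \<subseteq> M"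
    using maximal_subgroup_above[OF fin NG] by blast
  have MG: "subgroup M G" "M \<noteq> carrier G" using M(1) by (auto simp: maximal_subgroup_def)
  have PM: "P \<subseteq> M" using subset_normalizer[OF finP PG] M(2) by blast
  have "P \<noteq> {\<one>}" using P(2) one_is_normal by blast
  then have "p dvd card M"
    using prime_dvd_card_sylow[OF p P(1)] card_subgroup_dvd[OF PG MG(1) PM] dvd_trans by blast
  moreover have nn: "\<not> M \<lhd> G" using frattini[OF fin p P(1) _ M(2)] MG(2) by blast
  ultimately have nil: "nilpotent_group (G\<lparr>carrier := M\<rparr>)"
    using max M(1) by (auto simp: nilpotent_normal_or_prime_to_def)
  have "finite M" using fin finite_subset subgroup.subset[OF MG(1)] by blast
  then have "P \<lhd> G\<lparr>carrier := M\<rparr>"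
    using group.nilpotent_sylow_normal[OF subgroup_imp_group[OF MG(1)] _ nil p sylow_restrict[OF fin p P(1) MG(1) PM]]
    by simp
  then have "M \<subseteq> normalizer G P" using normal_in_normalizer[OF finP PG MG(1) PM] by blast
  then have eq: "normalizer G P = M" using M(2) by blast
  show "maximal_subgroup (normalizer G P) G" "nilpotent_group (G\<lparr>carrier := normalizer G P\<rparr>)"
    "\<not> normalizer G P \<lhd> G"
    unfolding eq using M nil nn by blast+
qed

text \<open>The order of \<open>M \<inter> L\<close> is divisible by the full power of every prime
  in the order of \<open>M\<close>, so the intersection is all of \<open>M\<close>.\<close>

lemma (in group) subset_of_subgroup_containing_sylows:
  assumes fin: "finite (carrier G)" and M: "subgroup M G" and L: "subgroup L G"
    and S: "\<And>q. Factorial_Ring.prime q \<Longrightarrow> \<exists>Q\<subseteq>L. sylow_subgroup (G\<lparr>carrier := M\<rparr>) q Q"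
  shows "M \<subseteq> L"
proof -
  have IG: "subgroup (M \<inter> L) G" using M L by (rule subgroups_Inter_pair)
  have finM: "finite M" using fin finite_subset subgroup.subset[OF M] by blast
  have pos: "card M \<noteq> 0" "card (M \<inter> L) \<noteq> 0"
    using subgroup.finite_imp_card_positive[OF M fin] subgroup.finite_imp_card_positive[OF IG fin] by auto
  have "card M dvd card (M \<inter> L)"
  proof (rule multiplicity_le_imp_dvd[OF pos(1)])
    fix q :: nat assume q: "Factorial_Ring.prime q"
    then obtain Q where Q: "Q \<subseteq> L" "sylow_subgroup (G\<lparr>carrier := M\<rparr>) q Q" using S by blast
    then have QM: "subgroup Q G" "Q \<subseteq> M" and cQ: "card Q = q ^ multiplicity q (card M)"
      using subgroup_restrict_iff[OF M] by (auto simp: sylow_subgroup_def order_def)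
    have "q ^ multiplicity q (card M) dvd card (M \<inter> L)"
      using card_subgroup_dvd[OF QM(1) IG] Q(1) QM(2) cQ by simp
    then show "multiplicity q (card M) \<le> multiplicity q (card (M \<inter> L))"
      using pos(2) q by (intro multiplicity_geI) (auto simp: prime_nat_iff)
  qed
  then have "card M \<le> card (M \<inter> L)" using pos(2) by (simp add: dvd_imp_le)
  then have "M \<inter> L = M" using finM by (intro card_seteq) auto
  then show ?thesis by blast
qed

text \<open>The last conclusion comes from \<open>D\<close>: a normal \<open>p\<close>-subgroup lies
  in every Sylow \<open>p\<close>-subgroup, hence in \<open>D\<close>, so it is enough that
  \<open>K\<close> contains \<open>D\<close>.\<close>

lemma (in group) nonnormal_sylow_p_quotient:
  assumes fin: "finite (carrier G)" and p: "Factorial_Ring.prime p"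
    and max: "nilpotent_normal_or_prime_to p G"
    and P: "sylow_subgroup G p P" "\<not> P \<lhd> G"
  obtains K k where "K \<lhd> G" "K \<noteq> carrier G" "order G = p ^ k * card K"
    "\<And>Z j. Z \<lhd> G \<Longrightarrow> card Z = p ^ j \<Longrightarrow> Z \<subseteq> K"
proof -
  let ?Q = "\<lambda>(S, T). sylow_subgroup G p S \<and> sylow_subgroup G p T \<and> S \<noteq> T"
  let ?f = "\<lambda>(S, T). card (S \<inter> T)"
  have sylG: "subgroup S G" "S \<subseteq> carrier G" "finite S" if "sylow_subgroup G p S" for S
    using that fin finite_subset subgroup.subset[of S G] by (auto simp: sylow_subgroup_def)
  have "\<exists>g\<in>carrier G. \<not> conjugate g ` P \<subseteq> P"
    using P(2) sylG(1)[OF P(1)] normal_iff_conjugate by blast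
  then obtain g where "g \<in> carrier G" "conjugate g ` P \<noteq> P" by blast
  then have ex: "?Q (P, conjugate g ` P)" using P(1) sylow_conjugate_image by auto
  have "\<forall>y. ?Q y \<longrightarrow> ?f y < Suc (order G)"
    using fin sylG(2) by (auto simp: less_Suc_eq_le order_def intro!: card_mono)
  then have "\<exists>y. ?Q y \<and> (\<forall>z. ?Q z \<longrightarrow> ?f z \<le> ?f y)"
    by (rule ex_has_greatest_nat[of ?Q _ ?f, OF ex])
  then obtain y where y: "?Q y" "\<forall>z. ?Q z \<longrightarrow> ?f z \<le> ?f y" by (elim exE conjE)
  obtain S T where "y = (S, T)" by (cases y)
  with y have S: "sylow_subgroup G p S" and T: "sylow_subgroup G p T" and ST: "S \<noteq> T"
    and best: "\<And>U V. sylow_subgroup G p U \<Longrightarrow> sylow_subgroup G p V \<Longrightarrow> U \<noteq> V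
      \<Longrightarrow> card (U \<inter> V) \<le> card (S \<inter> T)" by auto
  define D where "D = S \<inter> T"
  have DG: "subgroup D G" unfolding D_def using sylG(1)[OF S] sylG(1)[OF T] by (rule subgroups_Inter_pair)
  have finD: "finite D" using sylG(3)[OF S] by (simp add: D_def)
  have "card S = card T" using card_sylow[OF S] card_sylow[OF T] by simp
  then have "\<not> S \<subseteq> T" "\<not> T \<subseteq> S"
    using ST card_subset_eq[OF sylG(3)[OF S], of T] card_subset_eq[OF sylG(3)[OF T], of S] by auto
  then have DS: "D \<subset> S" and DT: "D \<subset> T" by (auto simp: D_def)
  \<comment> \<open>The pair with the largest intersection need not involve \<open>P\<close>, so
    nonnormality has to be established for \<open>S\<close>.\<close>
  have nS: "\<not> S \<lhd> G"
  proof
    assume "S \<lhd> G"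
    then have "T \<subseteq> S" using p_subgroup_in_normal_sylow[OF fin p S _ sylG(1)[OF T] card_sylow[OF T]] by blast
    then show False using DT by (auto simp: D_def)
  qed
  define M where "M = normalizer G S"
  have M: "maximal_subgroup M G" "nilpotent_group (G\<lparr>carrier := M\<rparr>)"
    unfolding M_def using sylow_normalizer_maximal[OF fin p max S nS] by blast+
  have MG: "subgroup M G" using M(1) by (simp add: maximal_subgroup_def)
  interpret M: group "G\<lparr>carrier := M\<rparr>" using MG by (rule subgroup_imp_group)
  have SM: "S \<subseteq> M" unfolding M_def using sylG[OF S] by (intro subset_normalizer)
  have SMn: "S \<lhd> G\<lparr>carrier := M\<rparr>"
    using normal_in_normalizer[OF sylG(3)[OF S] sylG(1)[OF S] MG SM] by (simp add: M_def)
  have Z_D: "Z \<subseteq> D" if "Z \<lhd> G" "card Z = p ^ j" for Z j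
    using normal_p_subgroup_in_sylow[OF fin p S that] normal_p_subgroup_in_sylow[OF fin p T that]
    by (simp add: D_def)
  obtain i where cD: "card D = p ^ i"
    using card_subgroup_of_p_group[OF p sylG(1)[OF S] card_sylow[OF S] DG] DS by blast
  show ?thesis
  proof (cases "D \<lhd> G")
    case True
    \<comment> \<open>Inside the nilpotent normalizer \<open>M\<close> of \<open>S\<close>, a
      central section of \<open>S\<close> above \<open>D\<close> provides the \<open>W\<close> for
      the transfer.\<close>
    have "D \<lhd> G\<lparr>carrier := M\<rparr>"
      using True DG DS SM subgroup.mem_carrier[OF MG]
      unfolding normal_restrict_iff[OF MG] normal_iff_conjugate by blast
    then obtain W where W: "W \<lhd> G\<lparr>carrier := M\<rparr>" "D \<subseteq> W" "W \<subset> S"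
      and comm: "\<And>x r. x \<in> S \<Longrightarrow> r \<in> M \<Longrightarrow> x \<otimes> r \<otimes> inv\<^bsub>G\<lparr>carrier := M\<rparr>\<^esub> x \<otimes> inv\<^bsub>G\<lparr>carrier := M\<rparr>\<^esub> r \<in> W"
      using M.nilpotent_commutator_subgroup[OF M(2) SMn _ DS] by auto
    have WG: "subgroup W G" using W(1) unfolding normal_restrict_iff[OF MG] by blast
    have comm': "x \<otimes> g \<otimes> inv x \<otimes> inv g \<in> W" if "x \<in> S" "g \<in> normalizer G S" for x g
    proof -
      have "x \<in> M" "g \<in> M" using that SM by (auto simp: M_def)
      then show ?thesis using comm[OF that(1)] m_inv_consistent[OF MG] by simp
    qed
    \<comment> \<open>A normal \<open>D\<close> lies in every Sylow \<open>p\<close>-subgroup, and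
      no intersection of two distinct ones is larger; so all these intersections equal
      \<open>D\<close>.\<close>
    have triv: "S \<inter> conjugate g ` S \<subseteq> D" if g: "g \<in> carrier G" "g \<notin> normalizer G S" for g
    proof -
      have C: "sylow_subgroup G p (conjugate g ` S)" using S g(1) by (rule sylow_conjugate_image)
      have "conjugate g ` S \<noteq> S"
        using g mem_normalizer_iff[OF sylG(3)[OF S] sylG(1)[OF S]] by blast
      then have "card (S \<inter> conjugate g ` S) \<le> card D" using best[OF S C] by (auto simp: D_def)
      moreover have "D \<subseteq> S \<inter> conjugate g ` S"
        using DS normal_p_subgroup_in_sylow[OF fin p C True cD] by blast
      moreover have "finite (S \<inter> conjugate g ` S)" using sylG(3)[OF S] by simp
      ultimately show ?thesis using card_seteq by blast
    qed
    obtain K k where "K \<lhd> G" "D \<subseteq> K" "K \<noteq> carrier G" "order G = p ^ k * card K"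
      using p_quotient_by_transfer[OF fin p S True W(2) WG W(3) comm' triv] by blast
    then show ?thesis using that Z_D by (meson subset_trans)
  next
    case False
    have NG: "subgroup (normalizer G D) G" using DG by (rule subgroup_normalizer)
    have "normalizer G D \<noteq> carrier G" using False normal_iff_normalizer[OF finD DG] by blast
    then obtain L where L: "maximal_subgroup L G" "normalizer G D \<subseteq> L"
      using maximal_subgroup_above[OF fin NG] by blast
    have LG: "subgroup L G" "L \<noteq> carrier G" using L(1) by (auto simp: maximal_subgroup_def)
    interpret L: group "G\<lparr>carrier := L\<rparr>" using LG(1) by (rule subgroup_imp_group)
    have finL: "finite L" using fin finite_subset subgroup.subset[OF LG(1)] by blast
    have DN: "D \<subseteq> normalizer G D" using finD DG by (rule subset_normalizer)
    \<comment> \<open>Within the \<open>p\<close>-group \<open>U\<close> the normalizer of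
      \<open>D\<close> is larger than \<open>D\<close>, and it lies in \<open>L\<close>; hence
      \<open>L\<close> meets \<open>U\<close> in more than \<open>D\<close>.\<close>
    have grow: "\<exists>R k. subgroup R G \<and> R \<subseteq> L \<and> card R = p ^ k \<and> D \<subset> R \<and> R \<subseteq> U"
      if U: "sylow_subgroup G p U" "D \<subset> U" for U
    proof -
      obtain x where x: "x \<in> U" "x \<notin> D" "x \<in> normalizer G D"
        using p_group_normalizer_grows[OF fin p sylG(1)[OF U(1)] card_sylow[OF U(1)] DG U(2)] .
      let ?R = "normalizer G D \<inter> U"
      have RG: "subgroup ?R G" using NG sylG(1)[OF U(1)] by (rule subgroups_Inter_pair)
      obtain k where "card ?R = p ^ k"
        using card_subgroup_of_p_group[OF p sylG(1)[OF U(1)] card_sylow[OF U(1)] RG] by blast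
      then show ?thesis using RG x DN U(2) L(2) by (intro exI[of _ ?R] exI[of _ k]) auto
    qed
    obtain R k where R: "subgroup R G" "R \<subseteq> L" "card R = p ^ k" "D \<subset> R" "R \<subseteq> S"
      using grow[OF S DS] by blast
    have "finite R" using R(5) sylG(3)[OF S] finite_subset by blast
    then have "card D < card R" using R(4) psubset_card_mono by blast
    then have "k \<noteq> 0" using R(3) cD p by (cases k) (auto simp: prime_nat_iff)
    then have "p dvd card R" using R(3) by (simp add: dvd_power)
    then have pL: "p dvd card L"
      using card_subgroup_dvd[OF R(1) LG(1) R(2)] dvd_trans by blast
    \<comment> \<open>Otherwise the Sylow \<open>p\<close>-subgroup \<open>B\<close> of
      \<open>L\<close> absorbs all \<open>p\<close>-subgroups of \<open>L\<close>. By
      \<open>grow\<close>, any Sylow subgroup \<open>U\<close> properly above \<open>D\<close> then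
      meets a fixed \<open>Y\<close> above \<open>B\<close> in more than \<open>D\<close>, so
      \<open>U = Y\<close> by the choice of \<open>D\<close>. This applies to both \<open>S\<close>
      and \<open>T\<close>.\<close>
    have "\<not> nilpotent_group (G\<lparr>carrier := L\<rparr>)"
    proof
      assume nil: "nilpotent_group (G\<lparr>carrier := L\<rparr>)"
      obtain B where B: "sylow_subgroup (G\<lparr>carrier := L\<rparr>) p B"
        using L.sylow_subgroup_exists[OF _ p] finL by auto
      have Bn: "B \<lhd> G\<lparr>carrier := L\<rparr>" using L.nilpotent_sylow_normal[OF _ nil p B] finL by simp
      have BG: "subgroup B G" using B subgroup_restrict_iff[OF LG(1)] by (auto simp: sylow_subgroup_def)
      obtain Y where Y: "sylow_subgroup G p Y" "B \<subseteq> Y"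
        using p_subgroup_in_sylow[OF fin p BG L.card_sylow[OF B]] .
      have eq: "U = Y" if U: "sylow_subgroup G p U" "D \<subset> U" for U
      proof (rule ccontr)
        assume ne: "U \<noteq> Y"
        obtain R k where R: "subgroup R G" "R \<subseteq> L" "card R = p ^ k" "D \<subset> R" "R \<subseteq> U"
          using grow[OF U] by blast
        have "subgroup R (G\<lparr>carrier := L\<rparr>)" using R subgroup_restrict_iff[OF LG(1)] by blast
        then have "R \<subseteq> B"
          using L.p_subgroup_in_normal_sylow[OF _ p B Bn _ R(3)] finL by simp
        then have "D \<subset> U \<inter> Y" using R Y(2) by blast
        then have "card D < card (U \<inter> Y)"
          using sylG(3)[OF U(1)] by (intro psubset_card_mono) auto
        then show False using best[OF U(1) Y(1) ne] by (simp add: D_def)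
      qed
      then show False using eq[OF S DS] eq[OF T DT] ST by blast
    qed
    then have Ln: "L \<lhd> G" using max L(1) pL by (auto simp: nilpotent_normal_or_prime_to_def)
    \<comment> \<open>If \<open>S\<close> were in \<open>L\<close>, so would be its whole normalizer
      \<open>M\<close>: for \<open>q\<close> other than \<open>p\<close> the Sylow
      \<open>q\<close>-subgroup of the nilpotent \<open>M\<close> commutes with \<open>S\<close>, so
      it normalizes \<open>D\<close> and lies in \<open>L\<close>. Frattini would then give
      \<open>L = carrier G\<close>.\<close>
    have "\<not> S \<subseteq> L"
    proof
      assume SL: "S \<subseteq> L"
      have "M \<subseteq> L"
      proof (rule subset_of_subgroup_containing_sylows[OF fin MG LG(1)])
        fix q :: nat assume q: "Factorial_Ring.prime q"
        have finM: "finite M" using fin finite_subset subgroup.subset[OF MG] by blast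
        show "\<exists>Q\<subseteq>L. sylow_subgroup (G\<lparr>carrier := M\<rparr>) q Q"
        proof (cases "q = p")
          case True
          then show ?thesis using SL sylow_restrict[OF fin p S MG SM] by blast
        next
          case False
          obtain Q where Q: "sylow_subgroup (G\<lparr>carrier := M\<rparr>) q Q"
            using M.sylow_subgroup_exists[OF _ q] finM by auto
          have Qn: "Q \<lhd> G\<lparr>carrier := M\<rparr>" using M.nilpotent_sylow_normal[OF _ M(2) q Q] finM by simp
          have QG: "subgroup Q G" "Q \<subseteq> M" using Q subgroup_restrict_iff[OF MG] by (auto simp: sylow_subgroup_def)
          have "coprime (card S) (card Q)"
            using card_sylow[OF S] M.card_sylow[OF Q] False p q by (simp add: primes_coprime)
          then have disj: "S \<inter> Q = {\<one>}" using coprime_subgroups_disjoint[OF fin sylG(1)[OF S] QG(1)] by blast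
          have "y \<in> L" if y: "y \<in> Q" for y
          proof -
            have yM: "y \<in> M" using y QG(2) by blast
            have "conjugate y x = x" if "x \<in> D" for x
              using M.normal_disjoint_commute[OF SMn Qn _ _ y, of x] disj that DS m_inv_consistent[OF MG yM] by auto
            then have "y \<in> normalizer G D"
              using mem_normalizer_iff[OF finD DG] subgroup.mem_carrier[OF MG yM] by auto
            then show ?thesis using L(2) by blast
          qed
          then show ?thesis using Q by blast
        qed
      qed
      then have "L = carrier G" using frattini[OF fin p S Ln] by (simp add: M_def)
      then show False using LG(2) by blast
    qed
    \<comment> \<open>Maximality of \<open>L\<close> makes the product with \<open>S\<close> the
      whole group, so the index of \<open>L\<close> divides the order of the \<open>p\<close>-group
      \<open>S\<close>.\<close>
    moreover have "L <#> S = L \<or> L <#> S = carrier G" and "S \<subseteq> L <#> S"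
      using L(1) subgroup_normal_mult[OF Ln sylG(1)[OF S]] unfolding maximal_subgroup_def by blast+
    ultimately have "L <#> S = carrier G" by blast
    then have c: "order G * card (L \<inter> S) = card L * card S"
      using card_normal_mult_subgroup[OF Ln sylG(1)[OF S] fin] by (simp add: order_def)
    obtain m where m: "order G = card L * m" using card_subgroup_dvd_order[OF LG(1)] by blast
    have "card L \<noteq> 0" using subgroup.finite_imp_card_positive[OF LG(1) fin] by simp
    then have "m dvd card S" using c m by (metis dvd_triv_left mult.assoc mult_left_cancel)
    then obtain e where "m = p ^ e" using card_sylow[OF S] divides_primepow_nat[OF p] by auto
    then have "order G = p ^ e * card L" using m by simp
    moreover have "Z \<subseteq> L" if "Z \<lhd> G" "card Z = p ^ j" for Z j
      using Z_D[OF that] DN L(2) by blast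
    ultimately show ?thesis using that Ln LG(2) by blast
  qed
qed

section \<open>A normal Sylow subgroup\<close>

text \<open>A maximal \<open>L\<close> of order prime to \<open>p\<close> must be \<open>K\<close>.
  If \<open>L\<close> contains \<open>K\<close>, its order divides that of \<open>K\<close>;
  otherwise \<open>K <#> L\<close> is the whole group, \<open>p ^ k\<close> divides the order of
  \<open>L\<close>, and \<open>k = 0\<close> contradicts \<open>K\<close> being proper. So every
  maximal subgroup is nilpotent or normal, and the prime becomes irrelevant.\<close>

lemma (in group) p_quotient_condition_all_primes:
  assumes fin: "finite (carrier G)" and p: "Factorial_Ring.prime p"
    and max: "nilpotent_normal_or_prime_to p G"
    and K: "K \<lhd> G" "K \<noteq> carrier G" "order G = p ^ k * card K"
  shows "nilpotent_normal_or_prime_to q G"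
proof -
  have "nilpotent_group (G\<lparr>carrier := L\<rparr>) \<or> L \<lhd> G" if L: "maximal_subgroup L G" for L
  proof (cases "p dvd card L")
    case True
    then show ?thesis using max L by (auto simp: nilpotent_normal_or_prime_to_def)
  next
    case False
    have LG: "subgroup L G" and KG: "subgroup K G"
      using L normal_imp_subgroup[OF K(1)] by (auto simp: maximal_subgroup_def)
    have finL: "finite L" using finite_subset[OF subgroup.subset[OF LG] fin] .
    have K0: "card K \<noteq> 0" using subgroup.finite_imp_card_positive[OF KG fin] by simp
    have "K <#> L = L \<or> K <#> L = carrier G"
      using L subgroup_normal_mult[OF K(1) LG] by (simp add: maximal_subgroup_def)
    then consider "K \<subseteq> L" | "K <#> L = carrier G"
      using subgroup_normal_mult(2)[OF K(1) LG] by blast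
    then have "K = L"
    proof cases
      case 1
      have "coprime (card L) (p ^ k)"
        using prime_imp_coprime[OF p False] by (simp add: coprime_commute)
      then have "card L dvd card K"
        using card_subgroup_dvd_order[OF LG] K(3) coprime_dvd_mult_right_iff by metis
      then have "card L \<le> card K" using K0 by (simp add: dvd_imp_le)
      then show ?thesis using card_seteq[OF finL 1] by simp
    next
      case 2
      then have "order G * card (K \<inter> L) = card K * card L"
        using card_normal_mult_subgroup[OF K(1) LG fin] by (simp add: order_def)
      then have "card K * (p ^ k * card (K \<inter> L)) = card K * card L"
        unfolding K(3) by (simp add: mult_ac)
      then have "p ^ k dvd card L" using K0 by (metis dvd_triv_left mult_left_cancel)
      then have "k = 0" using False by (cases k) (auto dest: dvd_mult_left)
      then have "card K = card (carrier G)" using K(3) by (simp add: order_def)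
      then have "K = carrier G" using card_subset_eq[OF fin subgroup.subset[OF KG]] by simp
      then show ?thesis using K(2) by blast
    qed
    then show ?thesis using K(1) by blast
  qed
  then show ?thesis by (auto simp: nilpotent_normal_or_prime_to_def)
qed

text \<open>The index of \<open>K \<inter> M\<close> in \<open>M\<close> is a power of
  \<open>q\<close>, since it equals the index of \<open>K\<close> in \<open>K <#> M\<close>. But
  \<open>K \<inter> M\<close> contains \<open>R\<close>, the full \<open>q\<close>-part of
  \<open>M\<close>, so the index is one.\<close>

lemma (in group) subset_of_q_quotient_kernel:
  assumes fin: "finite (carrier G)" and q: "Factorial_Ring.prime q"
    and K: "K \<lhd> G" "order G = q ^ k * card K" and M: "subgroup M G"
    and R: "sylow_subgroup (G\<lparr>carrier := M\<rparr>) q R" "R \<subseteq> K"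
  shows "M \<subseteq> K"
proof -
  have KG: "subgroup K G" using K(1) by (rule normal_imp_subgroup)
  have KM: "subgroup (K \<inter> M) G" using KG M by (rule subgroups_Inter_pair)
  have pos: "card K \<noteq> 0" "card M \<noteq> 0"
    using subgroup.finite_imp_card_positive[OF KG fin] subgroup.finite_imp_card_positive[OF M fin] by auto
  have RG: "subgroup R G" "R \<subseteq> M" and cR: "card R = q ^ multiplicity q (card M)"
    using R(1) subgroup_restrict_iff[OF M] by (auto simp: sylow_subgroup_def order_def)
  obtain i where i: "card (K <#> M) = card K * i"
    using card_subgroup_dvd[OF KG subgroup_normal_mult(1,2)[OF K(1) M]] by blast
  have "card K * i dvd card K * q ^ k"
    using card_subgroup_dvd_order[OF subgroup_normal_mult(1)[OF K(1) M]] i K(2) by (simp add: mult.commute)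
  then have "i dvd q ^ k" using pos(1) by simp
  then obtain j where j: "i = q ^ j" using divides_primepow_nat[OF q] by blast
  have "card K * (i * card (K \<inter> M)) = card K * card M"
    using card_normal_mult_subgroup[OF K(1) M fin] i by (simp add: mult_ac)
  then have cM: "i * card (K \<inter> M) = card M" using pos(1) by simp
  have "q ^ multiplicity q (card M) dvd card (K \<inter> M)"
    using card_subgroup_dvd[OF RG(1) KM] R(2) RG(2) cR by simp
  then have "q ^ (j + multiplicity q (card M)) dvd card M"
    unfolding power_add j[symmetric] by (subst (2) cM[symmetric]) (rule mult_dvd_mono[OF dvd_refl])
  then have "j + multiplicity q (card M) \<le> multiplicity q (card M)"
    using pos(2) q by (intro multiplicity_geI) (auto simp: prime_nat_iff)
  then have "card (K \<inter> M) = card M" using cM j by simp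
  moreover have "finite M" using finite_subset[OF subgroup.subset[OF M] fin] .
  ultimately have "K \<inter> M = M" by (intro card_subset_eq) auto
  then show ?thesis by blast
qed

lemma (in group) normal_sylow_exists:
  assumes fin: "finite (carrier G)" and p: "Factorial_Ring.prime p" "p dvd order G"
    and max: "nilpotent_normal_or_prime_to p G"
  shows "\<exists>q Q. Factorial_Ring.prime q \<and> q dvd order G \<and> sylow_subgroup G q Q \<and> Q \<lhd> G"
proof (rule ccontr)
  assume "\<not> ?thesis"
  then have none: "\<not> Q \<lhd> G" if "Factorial_Ring.prime q" "q dvd order G" "sylow_subgroup G q Q" for q Q
    using that by blast
  have o0: "order G \<noteq> 0" using fin order_gt_0_iff_finite by simp
  obtain P where P: "sylow_subgroup G p P" using sylow_subgroup_exists[OF fin p(1)] .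
  note nP = none[OF p P]
  \<comment> \<open>This \<open>K\<close> serves only to free the condition on maximal subgroups
    from the prime \<open>p\<close>.\<close>
  obtain K k where K: "K \<lhd> G" "K \<noteq> carrier G" "order G = p ^ k * card K"
    using nonnormal_sylow_p_quotient[OF fin p(1) max P nP] by metis
  have all: "nilpotent_normal_or_prime_to q G" for q
    using p_quotient_condition_all_primes[OF fin p(1) max K] .
  define M where "M = normalizer G P"
  have M: "maximal_subgroup M G" "nilpotent_group (G\<lparr>carrier := M\<rparr>)" "\<not> M \<lhd> G"
    unfolding M_def using sylow_normalizer_maximal[OF fin p(1) max P nP] by blast+
  have MG: "subgroup M G" "M \<noteq> carrier G" using M(1) by (auto simp: maximal_subgroup_def)
  interpret M: group "G\<lparr>carrier := M\<rparr>" using MG(1) by (rule subgroup_imp_group)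
  have finM: "finite M" using finite_subset[OF subgroup.subset[OF MG(1)] fin] .
  have M0: "card M \<noteq> 0" using subgroup.finite_imp_card_positive[OF MG(1) fin] by simp
  \<comment> \<open>As \<open>M\<close> is proper, some prime occurs in its order with a smaller
    exponent than in the order of the group; this is \<open>q\<close>.\<close>
  have "\<not> order G dvd card M"
  proof
    assume "order G dvd card M"
    then have "card (carrier G) \<le> card M" using M0 by (auto simp: order_def intro: dvd_imp_le)
    then show False using card_seteq[OF fin subgroup.subset[OF MG(1)]] MG(2) by simp
  qed
  then obtain q where q: "Factorial_Ring.prime q"
    and less: "multiplicity q (card M) < multiplicity q (order G)"
    using multiplicity_le_imp_dvd[OF o0, of "card M"] by (meson not_le)
  have qG: "q dvd order G" using less not_dvd_imp_multiplicity_0[of q "order G"] by fastforce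
  obtain R where R: "sylow_subgroup (G\<lparr>carrier := M\<rparr>) q R"
    using M.sylow_subgroup_exists[OF _ q] finM by auto
  have RG: "subgroup R G" "R \<subseteq> M" and cR: "card R = q ^ multiplicity q (card M)"
    using R subgroup_restrict_iff[OF MG(1)] by (auto simp: sylow_subgroup_def order_def)
  have finR: "finite R" using finM RG(2) finite_subset by blast
  have RM: "R \<lhd> G\<lparr>carrier := M\<rparr>" using M.nilpotent_sylow_normal[OF _ M(2) q R] finM by simp
  have "M \<subseteq> normalizer G R" using normal_in_normalizer[OF finR RG(1) MG(1) RG(2)] RM by blast
  then have "normalizer G R = M \<or> normalizer G R = carrier G"
    using M(1) subgroup_normalizer[OF RG(1)] by (simp add: maximal_subgroup_def)
  \<comment> \<open>Otherwise \<open>R\<close>, which is smaller than a Sylow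
    \<open>q\<close>-subgroup \<open>Q\<close> above it, would grow inside \<open>Q\<close> within
    its normalizer \<open>M\<close>. Yet the \<open>q\<close>-group \<open>M \<inter> Q\<close> is
    contained in the normal Sylow \<open>q\<close>-subgroup \<open>R\<close> of
    \<open>M\<close>.\<close>
  moreover have "normalizer G R \<noteq> M"
  proof
    assume N: "normalizer G R = M"
    obtain Q where Q: "sylow_subgroup G q Q" "R \<subseteq> Q" using p_subgroup_in_sylow[OF fin q RG(1) cR] .
    have QG: "subgroup Q G" using Q(1) by (simp add: sylow_subgroup_def)
    have "card R < card Q" using cR card_sylow[OF Q(1)] less prime_gt_1_nat[OF q] by simp
    then have "R \<subset> Q" using Q(2) by auto
    then obtain x where x: "x \<in> Q" "x \<notin> R" "x \<in> M"
      using p_group_normalizer_grows[OF fin q QG card_sylow[OF Q(1)] RG(1)] N by metis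
    have MQ: "subgroup (M \<inter> Q) G" using MG(1) QG by (rule subgroups_Inter_pair)
    obtain i where i: "card (M \<inter> Q) = q ^ i"
      using card_subgroup_of_p_group[OF q QG card_sylow[OF Q(1)] MQ] by blast
    have "subgroup (M \<inter> Q) (G\<lparr>carrier := M\<rparr>)" using MQ subgroup_restrict_iff[OF MG(1)] by blast
    then have "M \<inter> Q \<subseteq> R" using M.p_subgroup_in_normal_sylow[OF _ q R RM _ i] finM by simp
    then show False using x by blast
  qed
  ultimately have Rn: "R \<lhd> G" using normal_iff_normalizer[OF finR RG(1)] by blast
  obtain Q where Q: "sylow_subgroup G q Q" using sylow_subgroup_exists[OF fin q] .
  \<comment> \<open>Now the quotient argument is applied to \<open>q\<close>: its kernel contains
    every normal \<open>q\<close>-subgroup, in particular \<open>R\<close>.\<close>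
  obtain K' k' where K': "K' \<lhd> G" "K' \<noteq> carrier G" "order G = q ^ k' * card K'" "R \<subseteq> K'"
    using nonnormal_sylow_p_quotient[OF fin q all Q none[OF q qG Q]] Rn cR by metis
  have "M \<subseteq> K'" using subset_of_q_quotient_kernel[OF fin q K'(1,3) MG(1) R K'(4)] .
  then have "K' = M"
    using M(1) normal_imp_subgroup[OF K'(1)] K'(2) by (auto simp: maximal_subgroup_def)
  then show False using M(3) K'(1) by blast
qed

section \<open>Passage of the hypothesis to quotients\<close>

lemma (in group_hom) lower_central_image:
  assumes "h ` carrier G = carrier H"
  shows "lower_central H n = h ` lower_central G n"
proof (induction n)
  case 0
  then show ?case using assms by simp
next
  case (Suc n)
  let ?S = "{x \<otimes> y \<otimes> inv x \<otimes> inv y | x y. x \<in> lower_central G n \<and> y \<in> carrier G}"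
  let ?T = "{x \<otimes>\<^bsub>H\<^esub> y \<otimes>\<^bsub>H\<^esub> inv\<^bsub>H\<^esub> x \<otimes>\<^bsub>H\<^esub> inv\<^bsub>H\<^esub> y | x y. x \<in> lower_central H n \<and> y \<in> carrier H}"
  have sub: "lower_central G n \<subseteq> carrier G"
    using subgroup.subset[OF normal_imp_subgroup[OF G.lower_central_normal]] .
  have eq: "h (x \<otimes> y \<otimes> inv x \<otimes> inv y) = h x \<otimes>\<^bsub>H\<^esub> h y \<otimes>\<^bsub>H\<^esub> inv\<^bsub>H\<^esub> h x \<otimes>\<^bsub>H\<^esub> inv\<^bsub>H\<^esub> h y"
    if "x \<in> lower_central G n" "y \<in> carrier G" for x y
    using that sub by (auto simp: subset_iff)
  have "?T = h ` ?S"
  proof (intro equalityI subsetI)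
    fix z assume "z \<in> ?T"
    then obtain x y where "x \<in> lower_central G n" "y \<in> carrier G"
      "z = h x \<otimes>\<^bsub>H\<^esub> h y \<otimes>\<^bsub>H\<^esub> inv\<^bsub>H\<^esub> h x \<otimes>\<^bsub>H\<^esub> inv\<^bsub>H\<^esub> h y"
      unfolding Suc assms[symmetric] by blast
    then show "z \<in> h ` ?S" using eq by (intro image_eqI[of _ h]) auto
  next
    fix z assume "z \<in> h ` ?S"
    then obtain x y where "x \<in> lower_central G n" "y \<in> carrier G" "z = h (x \<otimes> y \<otimes> inv x \<otimes> inv y)"
      by blast
    then show "z \<in> ?T" using eq unfolding Suc assms[symmetric] by blast
  qed
  moreover have "?S \<subseteq> carrier G" using sub by auto
  ultimately show ?case using generate_img[of ?S] by simp
qed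

lemma (in group_hom) nilpotent_image:
  assumes "h ` carrier G = carrier H" "nilpotent_group G"
  shows "nilpotent_group H"
  using assms lower_central_image[OF assms(1)] unfolding nilpotent_group_def
  by (metis H.is_group hom_one image_empty image_insert)

text \<open>Elements of \<open>G Mod N\<close> are cosets, so \<open>\<Union>A\<close> is the full
  preimage of \<open>A\<close>, and its cosets of \<open>N\<close> are exactly the elements of
  \<open>A\<close>.\<close>

lemma (in group) card_factgroup_union:
  assumes N: "N \<lhd> G" and A: "subgroup A (G Mod N)"
  shows "card (\<Union>A) = card A * card N"
proof -
  have U: "subgroup (\<Union>A) G" using normal.factgroup_subgroup_union_subgroup[OF N A] .
  have NU: "N \<subseteq> \<Union>A" using subgroup.one_closed[OF A] by auto
  have "card (rcosets\<^bsub>G\<lparr>carrier := \<Union>A\<rparr>\<^esub> N) * card N = card (\<Union>A)"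
    using group.lagrange[OF subgroup_imp_group[OF U]] subgroup_incl[OF normal_imp_subgroup[OF N] U NU]
    by (simp add: order_def)
  then show ?thesis using normal.factgroup_subgroup_union_factor[OF N A] by simp
qed

text \<open>The correspondence theorem for the full preimage \<open>\<Union>A\<close>: an overgroup
  of it maps to an overgroup of \<open>A\<close>. Nilpotency and normality descend because they
  survive surjective homomorphisms.\<close>

lemma (in group) maximal_subgroup_of_quotient:
  assumes N: "N \<lhd> G" and A: "maximal_subgroup A (G Mod N)"
  shows "maximal_subgroup (\<Union>A) G"
    "nilpotent_group (G\<lparr>carrier := \<Union>A\<rparr>) \<Longrightarrow> nilpotent_group ((G Mod N)\<lparr>carrier := A\<rparr>)"
    "\<Union>A \<lhd> G \<Longrightarrow> A \<lhd> G Mod N"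
proof -
  have AG: "subgroup A (G Mod N)" "A \<noteq> carrier (G Mod N)"
    and Amax: "\<And>B. subgroup B (G Mod N) \<Longrightarrow> A \<subseteq> B \<Longrightarrow> B = A \<or> B = carrier (G Mod N)"
    using A by (auto simp: maximal_subgroup_def)
  define h where "h x = N #> x" for x
  define M where "M = \<Union>A"
  have M_iff: "x \<in> M \<longleftrightarrow> x \<in> carrier G \<and> h x \<in> A" for x
    using normal.factgroup_subgroup_union_char[OF N AG(1)] by (auto simp: M_def h_def)
  have MG: "subgroup M G" unfolding M_def using normal.factgroup_subgroup_union_subgroup[OF N AG(1)] .
  interpret Q: group "G Mod N" using N by (rule normal.factorgroup_is_group)
  have hom: "h \<in> hom G (G Mod N)"
    using normal.r_coset_hom_Mod[OF N] by (simp add: h_def[abs_def])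
  interpret h: group_hom G "G Mod N" h
    using hom by (simp add: group_hom_def group_hom_axioms_def Q.group_axioms)
  have car: "carrier (G Mod N) = h ` carrier G" by (auto simp: h_def carrier_FactGroup)
  have hM: "h ` M = A"
  proof
    show "h ` M \<subseteq> A" using M_iff by auto
    show "A \<subseteq> h ` M"
    proof
      fix a assume a: "a \<in> A"
      then obtain x where "x \<in> carrier G" "a = h x" using subgroup.subset[OF AG(1)] car by auto
      then show "a \<in> h ` M" using a M_iff by simp
    qed
  qed
  have NG: "subgroup N G" using N by (rule normal_imp_subgroup)
  \<comment> \<open>A subgroup containing \<open>N\<close> is a union of fibres of \<open>h\<close>,
    so it can be recovered from its image.\<close>
  have h_eq: "x \<in> U" if U: "subgroup U G" "N \<subseteq> U" "y \<in> U" and x: "x \<in> carrier G" "h x = h y" for x y U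
  proof -
    have "x \<in> N #> y" using x rcos_self[OF x(1) NG] by (simp add: h_def)
    then show ?thesis using U subgroup.m_closed[OF U(1)] by (auto simp: r_coset_def)
  qed
  have NM: "N \<subseteq> M" unfolding M_def using subgroup.one_closed[OF AG(1)] by auto
  have "U = M \<or> U = carrier G" if U: "subgroup U G" "M \<subseteq> U" for U
  proof -
    have "A \<subseteq> h ` U" using U(2) hM by blast
    then consider "h ` U = A" | "h ` U = carrier (G Mod N)"
      using Amax h.subgroup_img_is_subgroup[OF U(1)] by blast
    then show ?thesis
    proof cases
      case 1
      then have "U \<subseteq> M" using M_iff subgroup.mem_carrier[OF U(1)] by blast
      then show ?thesis using U(2) by blast
    next
      case 2
      have "carrier G \<subseteq> U"
      proof
        fix x assume x: "x \<in> carrier G"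
        then obtain y where "y \<in> U" "h x = h y" using 2 car by blast
        then show "x \<in> U" using h_eq[OF U(1) _ _ x] NM U(2) by blast
      qed
      then show ?thesis using subgroup.subset[OF U(1)] by blast
    qed
  qed
  moreover have "M \<noteq> carrier G" using AG(2) hM car by blast
  ultimately show "maximal_subgroup (\<Union>A) G"
    using MG unfolding maximal_subgroup_def M_def by blast
  show "nilpotent_group ((G Mod N)\<lparr>carrier := A\<rparr>)" if "nilpotent_group (G\<lparr>carrier := \<Union>A\<rparr>)"
  proof -
    interpret r: group_hom "G\<lparr>carrier := M\<rparr>" "(G Mod N)\<lparr>carrier := A\<rparr>" h
      using subgroup_imp_group[OF MG] Q.subgroup_imp_group[OF AG(1)] hM subgroup.mem_carrier[OF MG] h.hom_mult
      by (auto simp: group_hom_def group_hom_axioms_def hom_def)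
    show ?thesis using r.nilpotent_image hM that by (simp add: M_def)
  qed
  show "A \<lhd> G Mod N" if "\<Union>A \<lhd> G"
    using normal.surj_hom_normal_subgroup[OF that h.group_hom_axioms car[symmetric]] hM by (simp add: M_def)
qed

text \<open>The order of \<open>\<Union>A\<close> is that of \<open>A\<close> times that of
  \<open>N\<close>. If \<open>p\<close> divides the order of \<open>N\<close>, no preimage has order
  prime to \<open>p\<close>, so the third alternative disappears and \<open>q\<close> is arbitrary.
  If \<open>p = q\<close>, that alternative passes from the preimage to \<open>A\<close>.\<close>

lemma (in group) quotient_condition:
  assumes N: "N \<lhd> G" and max: "nilpotent_normal_or_prime_to p G"
    and pq: "p = q \<or> p dvd card N"
  shows "nilpotent_normal_or_prime_to q (G Mod N)"
  unfolding nilpotent_normal_or_prime_to_def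
proof (intro allI impI)
  fix A assume A: "maximal_subgroup A (G Mod N)"
  have "card (\<Union>A) = card A * card N"
    using card_factgroup_union[OF N] A by (simp add: maximal_subgroup_def)
  then have "\<not> p dvd card (\<Union>A) \<Longrightarrow> \<not> q dvd card A" using pq by auto
  then show "nilpotent_group ((G Mod N)\<lparr>carrier := A\<rparr>) \<or> A \<lhd> G Mod N \<or> \<not> q dvd card A"
    using maximal_subgroup_of_quotient[OF N A] max unfolding nilpotent_normal_or_prime_to_def by blast
qed

section \<open>The Sylow tower\<close>

lemma (in group) set_prod_list_closed:
  "(\<And>P. P \<in> set Ps \<Longrightarrow> P \<subseteq> carrier G) \<Longrightarrow> set_prod_list G Ps \<subseteq> carrier G"
proof (induction Ps)
  case (Cons P Ps)
  then show ?case by (simp add: setmult_subset_G)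
qed simp

text \<open>The recursion of \<open>set_prod_list\<close> adds factors on the left, whereas the
  tower grows on the right.\<close>

lemma (in group) set_prod_list_snoc:
  assumes "\<And>P. P \<in> set Ps \<Longrightarrow> P \<subseteq> carrier G" "Q \<subseteq> carrier G"
  shows "set_prod_list G (Ps @ [Q]) = set_prod_list G Ps <#> Q"
  using assms(1)
proof (induction Ps)
  case Nil
  have "Q <#> {\<one>} = Q" "{\<one>} <#> Q = Q"
    using assms(2) by (auto simp: set_mult_def subset_iff)
  then show ?case by simp
next
  case (Cons P Ps)
  then show ?case
    using assms(2) set_prod_list_closed[of Ps] by (simp add: set_mult_assoc)
qed

text \<open>The preimage \<open>T\<close> of \<open>S\<close> is normal and its order is that of
  \<open>N\<close> times the full \<open>q\<close>-part of the group. A Sylow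
  \<open>q\<close>-subgroup \<open>Q\<close> of \<open>T\<close> is therefore Sylow in the whole
  group and meets \<open>N\<close> trivially, so \<open>N <#> Q\<close> fills \<open>T\<close> by
  order.\<close>

lemma (in group) normal_hall_extension:
  assumes fin: "finite (carrier G)" and q: "Factorial_Ring.prime q" and N: "N \<lhd> G" "\<not> q dvd card N"
    and S: "sylow_subgroup (G Mod N) q S" "S \<lhd> G Mod N"
  obtains Q where "sylow_subgroup G q Q" "N <#> Q \<lhd> G"
    "card (N <#> Q) = card N * q ^ multiplicity q (order G)"
proof -
  have NG: "subgroup N G" using N(1) by (rule normal_imp_subgroup)
  have N0: "card N \<noteq> 0" using subgroup.finite_imp_card_positive[OF NG fin] by simp
  have o0: "order G \<noteq> 0" using fin order_gt_0_iff_finite by simp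
  have "order G = order (G Mod N) * card N" using lagrange[OF NG] by (simp add: FactGroup_def order_def)
  then have "multiplicity q (order G) = multiplicity q (order (G Mod N))"
    using o0 q N(2) by (simp add: prime_elem_multiplicity_mult_distrib not_dvd_imp_multiplicity_0)
  then have cS: "card S = q ^ multiplicity q (order G)" using S(1) by (simp add: sylow_subgroup_def)
  define T where "T = \<Union>S"
  have SG: "subgroup S (G Mod N)" using S(1) by (simp add: sylow_subgroup_def)
  have T: "T \<lhd> G" unfolding T_def using normal.factgroup_subgroup_union_normal[OF N(1) S(2)] .
  have TG: "subgroup T G" using T by (rule normal_imp_subgroup)
  have finT: "finite T" using finite_subset[OF subgroup.subset[OF TG] fin] .
  have NT: "N \<subseteq> T" unfolding T_def using subgroup.one_closed[OF SG] by auto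
  have cT: "card T = card N * q ^ multiplicity q (order G)"
    unfolding T_def using card_factgroup_union[OF N(1) SG] cS by simp
  then have mT: "multiplicity q (card T) = multiplicity q (order G)"
    using N0 N(2) q by (simp add: prime_elem_multiplicity_mult_distrib not_dvd_imp_multiplicity_0 multiplicity_same_power
        prime_nat_iff)
  interpret T: group "G\<lparr>carrier := T\<rparr>" using TG by (rule subgroup_imp_group)
  obtain Q where Q: "sylow_subgroup (G\<lparr>carrier := T\<rparr>) q Q"
    using T.sylow_subgroup_exists[OF _ q] finT by auto
  have QG: "subgroup Q G" "Q \<subseteq> T" and cQ: "card Q = q ^ multiplicity q (order G)"
    using Q subgroup_restrict_iff[OF TG] mT by (auto simp: sylow_subgroup_def order_def)
  have "coprime (card N) (card Q)"
    unfolding cQ using prime_imp_coprime[OF q N(2)] by (simp add: coprime_commute)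
  then have "N \<inter> Q = {\<one>}" by (rule coprime_subgroups_disjoint[OF fin NG QG(1)])
  then have cNQ: "card (N <#> Q) = card T"
    using card_normal_mult_subgroup[OF N(1) QG(1) fin] cT cQ by simp
  have "N <#> Q \<subseteq> T"
    using NT QG(2) subgroup.m_closed[OF TG] by (auto simp: set_mult_def)
  then have "N <#> Q = T" using card_subset_eq[OF finT] cNQ by blast
  then show ?thesis using that[of Q] QG(1) cQ T cT by (simp add: sylow_subgroup_def)
qed

lemma (in group) sylow_tower_prefix:
  assumes fin: "finite (carrier G)" and p: "Factorial_Ring.prime p" "p dvd order G"
    and max: "nilpotent_normal_or_prime_to p G"
    and "j \<le> card (prime_factors (order G))"
  shows "\<exists>ps Ps. distinct ps \<and> set ps \<subseteq> prime_factors (order G) \<and> length ps = j \<and> length Ps = j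
    \<and> (\<forall>i<j. sylow_subgroup G (ps ! i) (Ps ! i)) \<and> (\<forall>k\<le>j. set_prod_list G (take k Ps) \<lhd> G)
    \<and> card (set_prod_list G Ps) = (\<Prod>q\<in>set ps. q ^ multiplicity q (order G))"
  using assms(5)
proof (induction j)
  case 0
  then show ?case using one_is_normal by auto
next
  case (Suc j)
  then obtain ps Ps where dist: "distinct ps" and sub: "set ps \<subseteq> prime_factors (order G)"
    and len: "length ps = j" "length Ps = j"
    and syl: "\<forall>i<j. sylow_subgroup G (ps ! i) (Ps ! i)"
    and norm: "\<forall>k\<le>j. set_prod_list G (take k Ps) \<lhd> G"
    and cN: "card (set_prod_list G Ps) = (\<Prod>q\<in>set ps. q ^ multiplicity q (order G))"
    using Suc_leD by blast
  define N where "N = set_prod_list G Ps"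
  have N: "N \<lhd> G" using norm len(2) by (auto simp: N_def)
  have NG: "subgroup N G" using N by (rule normal_imp_subgroup)
  have o0: "order G \<noteq> 0" using fin order_gt_0_iff_finite by simp
  have idx: "order G = order (G Mod N) * card N" using lagrange[OF NG] by (simp add: FactGroup_def order_def)
  have multN: "multiplicity q (card N) = (if q \<in> set ps then multiplicity q (order G) else 0)"
    if "Factorial_Ring.prime q" for q
    unfolding N_def cN using that sub by (subst multiplicity_prod_prime_powers) (auto simp: in_prime_factors_iff)
  have N0: "card N \<noteq> 0" and Q0: "order (G Mod N) \<noteq> 0" using idx o0 by auto
  have multQ: "multiplicity q (order (G Mod N)) = (if q \<in> set ps then 0 else multiplicity q (order G))"
    if q: "Factorial_Ring.prime q" for q
  proof -
    have "multiplicity q (order G) = multiplicity q (order (G Mod N)) + multiplicity q (card N)"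
      using q N0 Q0 unfolding idx by (simp add: prime_elem_multiplicity_mult_distrib)
    then show ?thesis using multN[OF q] by auto
  qed
  have pos: "q dvd n \<longleftrightarrow> multiplicity q n \<noteq> 0" if "Factorial_Ring.prime q" "n \<noteq> 0" for q n :: nat
    using that prime_multiplicity_gt_zero_iff[of q n] by simp
  have dvdN: "q dvd card N \<longleftrightarrow> q \<in> set ps" if q: "Factorial_Ring.prime q" "q dvd order G" for q
    using multN[OF q(1)] q(2) pos[OF q(1)] N0 o0 by simp
  have dvdQ: "q dvd order (G Mod N) \<longleftrightarrow> q \<notin> set ps" if q: "Factorial_Ring.prime q" "q dvd order G" for q
    using multQ[OF q(1)] q(2) pos[OF q(1)] Q0 o0 by simp
  have "card (set ps) < card (prime_factors (order G))" using dist len(1) Suc.prems by (simp add: distinct_card)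
  then obtain q0 where q0: "q0 \<in> prime_factors (order G)" "q0 \<notin> set ps"
    using sub by (metis card_mono finite_set not_le subsetI)
  obtain r where r: "Factorial_Ring.prime r" "r dvd order (G Mod N)" "nilpotent_normal_or_prime_to r (G Mod N)"
  proof (cases "p \<in> set ps")
    case True
    then show ?thesis
      using that[of q0] q0 dvdQ[of q0] dvdN[OF p] quotient_condition[OF N max] by (auto simp: in_prime_factors_iff)
  next
    case False
    then show ?thesis using that[of p] p dvdQ[OF p] quotient_condition[OF N max] by auto
  qed
  interpret GN: group "G Mod N" using N by (rule normal.factorgroup_is_group)
  have "finite (carrier (G Mod N))" using Q0 GN.order_gt_0_iff_finite by simp
  then obtain q S where q: "Factorial_Ring.prime q" "q dvd order (G Mod N)"
    and S: "sylow_subgroup (G Mod N) q S" "S \<lhd> G Mod N"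
    using GN.normal_sylow_exists[OF _ r] by blast
  have qG: "q dvd order G" using q(2) idx by (metis dvd_mult2)
  have qps: "q \<notin> set ps" using dvdQ[OF q(1) qG] q(2) by blast
  then have "\<not> q dvd card N" using dvdN[OF q(1) qG] by blast
  then obtain Q where Q: "sylow_subgroup G q Q" "N <#> Q \<lhd> G"
    "card (N <#> Q) = card N * q ^ multiplicity q (order G)"
    using normal_hall_extension[OF fin q(1) N _ S] by blast
  have PsG: "P \<subseteq> carrier G" if "P \<in> set Ps" for P
    using that syl len(2) subgroup.subset by (metis in_set_conv_nth sylow_subgroup_def)
  have "Q \<subseteq> carrier G" using Q(1) subgroup.subset by (auto simp: sylow_subgroup_def)
  then have snoc: "set_prod_list G (Ps @ [Q]) = N <#> Q" using set_prod_list_snoc PsG by (simp add: N_def)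
  show ?case
  proof (intro exI conjI)
    show "distinct (ps @ [q])" using dist qps by simp
    show "set (ps @ [q]) \<subseteq> prime_factors (order G)"
      using sub q(1) qG o0 by (simp add: in_prime_factors_iff)
    show "length (ps @ [q]) = Suc j" "length (Ps @ [Q]) = Suc j" using len by simp_all
    show "\<forall>i<Suc j. sylow_subgroup G ((ps @ [q]) ! i) ((Ps @ [Q]) ! i)"
      using syl len Q(1) by (auto simp: nth_append less_Suc_eq)
    show "\<forall>k\<le>Suc j. set_prod_list G (take k (Ps @ [Q])) \<lhd> G"
    proof (intro allI impI)
      fix k assume "k \<le> Suc j"
      then consider "k \<le> j" | "k = Suc j" by linarith
      then show "set_prod_list G (take k (Ps @ [Q])) \<lhd> G"
        using norm len(2) snoc Q(2) by cases auto
    qed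
    show "card (set_prod_list G (Ps @ [Q])) = (\<Prod>q\<in>set (ps @ [q]). q ^ multiplicity q (order G))"
      using Q(3) qps cN by (simp add: snoc N_def mult.commute)
  qed
qed

theorem theorem1p4:
  fixes G :: "('a, 'b) monoid_scheme" and p :: nat
  assumes "group G" and "finite (carrier G)"
    and "Factorial_Ring.prime p" and "p dvd order G"
    and "\<forall>M. maximal_subgroup M G \<longrightarrow>
           nilpotent_group (G\<lparr>carrier := M\<rparr>) \<or> M \<lhd> G \<or> \<not> p dvd card M"
  shows "has_sylow_tower G"
proof -
  interpret group G by fact
  let ?s = "card (prime_factors (order G))"
  have "nilpotent_normal_or_prime_to p G" using assms(5) by (simp add: nilpotent_normal_or_prime_to_def)
  then obtain ps Ps where ps: "distinct ps" "set ps \<subseteq> prime_factors (order G)"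
    and len: "length ps = ?s" "length Ps = ?s"
    and syl: "\<forall>i<?s. sylow_subgroup G (ps ! i) (Ps ! i)"
    and norm: "\<forall>k\<le>?s. set_prod_list G (take k Ps) \<lhd> G"
    using sylow_tower_prefix[OF assms(2-4), of ?s] by blast
  \<comment> \<open>With as many distinct primes as there are prime divisors, none is left
    out.\<close>
  have "set ps = prime_factors (order G)"
    using ps len(1) by (intro card_subset_eq) (simp_all add: distinct_card)
  then show ?thesis
    unfolding has_sylow_tower_def using ps(1) len syl norm by (intro exI[of _ ps] exI[of _ Ps]) auto
qed

end
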